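(* Let $\alpha_1,\ldots,\alpha_\ell\in\mathbb{R}$ with $\ell\ge 2$. Suppose that $(x_n)_{n=0}^\infty$ is an $(\alpha_1,\ldots,\alpha_\ell)$-orbit in $\mathbb{T}$ passing through infinitely many points (i.e. the set $\{x_n: n\ge 0\}$ is infinite). Let $K$ be the closure of the set $\{x_n:\ n\ge 0\}$. Then the following statements hold. (i) If $\ell=2$, then either $K-K=\mathbb{T}$ or $K$ has a non-empty interior; in particular, $\underline{\dim}_B K\ge 1/2$. (ii) If $\ell\ge 2$, then $$\underline{\dim}_B K\ge\begin{cases}1, & \text{if } r=1,\\ 1/(r+1), & \text{if } r>1,\end{cases}$$ where $r=\dim\mathrm{span}_{\mathbb{Q}}(1,\alpha_1,\ldots,\alpha_\ell)-1$.
   Context: $\mathbb{T}=\mathbb{R}/\mathbb{Z}$ is the unit circle (viewed as $[0,1]$ with endpoints identified), and $\pi:\mathbb{R}\to\mathbb{T}$ is the canonical map $x\mapsto\{x\}$ (fractional part). A sequence $(x_n)_{n=0}^\infty$ of points in $\mathbb{T}$ is called an $(\alpha_1,\ldots,\alpha_\ell)$-orbit if $x_{n+1}-x_n\in\{\pi(\alpha_1),\ldots,\pi(\alpha_\ell)\}$ for all $n\ge 0$. $K-K=\{x-y: x,y\in K\}$ is the algebraic difference in $\mathbb{T}$. $\underline{\dim}_B$ denotes lower box-counting dimension. For real numbers $u_1,\dots,u_k$, $\mathrm{span}_{\mathbb{Q}}(u_1,\ldots,u_k)=\{\sum_{i=1}^k t_iu_i: t_i\in\mathbb{Q}\}$,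 with dimension taken over $\mathbb{Q}$. *)

theory Defs
  imports "HOL-Analysis.Analysis"
begin

text \<open>The circle \<open>\<real>/\<int>\<close>, as an additive group with the metric induced by the distance to the
  nearest integer.\<close>

quotient_type circle = real / "\<lambda>x y :: real. x - y \<in> \<int>"
  morphisms rep_circle circle_of
proof (rule equivpI)
  show "reflp (\<lambda>x y :: real. x - y \<in> \<int>)"
    by (simp add: reflp_def)
  show "symp (\<lambda>x y :: real. x - y \<in> \<int>)"
    unfolding symp_def by (metis Ints_minus minus_diff_eq)
  show "transp (\<lambda>x y :: real. x - y \<in> \<int>)"
    unfolding transp_def by (metis Ints_add diff_add_cancel add_diff_eq)
qed

instantiation circle :: ab_group_add
begin

lift_definition zero_circle :: circle is "0 :: real" .

lift_definition plus_circle :: "circle \<Rightarrow> circle \<Rightarrow> circle" is "(+) :: real \<Rightarrow> real \<Rightarrow> real"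
  by (metis Ints_add add_diff_add)

lift_definition uminus_circle :: "circle \<Rightarrow> circle" is "uminus :: real \<Rightarrow> real"
  by (metis Ints_minus minus_diff_minus)

lift_definition minus_circle :: "circle \<Rightarrow> circle \<Rightarrow> circle" is "(-) :: real \<Rightarrow> real \<Rightarrow> real"
  by (metis Ints_diff diff_diff_eq2 diff_diff_eq add_diff_eq diff_add_eq add.commute)

instance
  by (standard; transfer) (simp_all add: algebra_simps)

end

lemma round_diff_Ints:
  fixes s t :: real
  assumes "s - t \<in> \<int>"
  shows "s - of_int (round s) = t - of_int (round t)"
proof -
  obtain k where "s - t = of_int k"
    using assms by (auto elim: Ints_cases)
  then have s: "s = t + of_int k"
    by simp
  have "round s = round t + k"
    unfolding s round_def by (metis add.assoc add.commute floor_add_int)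
  then show ?thesis
    using s by simp
qed

lemma round_dist_triangle:
  fixes s t :: real
  shows "\<bar>s + t - of_int (round (s + t))\<bar> \<le> \<bar>s - of_int (round s)\<bar> + \<bar>t - of_int (round t)\<bar>"
proof -
  have "\<bar>s + t - of_int (round (s + t))\<bar> \<le> \<bar>s + t - of_int (round s + round t)\<bar>"
    by (rule round_diff_minimal)
  then show ?thesis
    by simp
qed

instantiation circle :: metric_space
begin

lift_definition dist_circle :: "circle \<Rightarrow> circle \<Rightarrow> real"
  is "\<lambda>x y :: real. \<bar>(x - y) - of_int (round (x - y))\<bar>"
proof -
  fix x x' y y' :: real
  assume "x - x' \<in> \<int>" "y - y' \<in> \<int>"
  then have "(x - y) - (x' - y') \<in> \<int>"
    using Ints_diff[of "x - x'" "y - y'"] by (simp add: algebra_simps)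
  then show "\<bar>(x - y) - of_int (round (x - y))\<bar> = \<bar>(x' - y') - of_int (round (x' - y'))\<bar>"
    using round_diff_Ints by metis
qed

definition uniformity_circle :: "(circle \<times> circle) filter"
  where "uniformity_circle = (INF e\<in>{0<..}. principal {(x, y). dist x y < e})"

definition open_circle :: "circle set \<Rightarrow> bool"
  where "open_circle U \<longleftrightarrow> (\<forall>x\<in>U. eventually (\<lambda>(x', y). x' = x \<longrightarrow> y \<in> U) uniformity)"

instance
proof
  fix x y z :: circle and U :: "circle set"
  show "(uniformity :: (circle \<times> circle) filter) = (INF e\<in>{0<..}. principal {(x, y). dist x y < e})"
    by (rule uniformity_circle_def)
  show "open U \<longleftrightarrow> (\<forall>x\<in>U. eventually (\<lambda>(x', y). x' = x \<longrightarrow> y \<in> U) uniformity)"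
    by (rule open_circle_def)
  show "dist x y = 0 \<longleftrightarrow> x = y"
  proof transfer
    fix x y :: real
    show "\<bar>(x - y) - of_int (round (x - y))\<bar> = 0 \<longleftrightarrow> x - y \<in> \<int>"
      by (metis Ints_cases Ints_of_int abs_eq_0 eq_iff_diff_eq_0 round_of_int)
  qed
  show "dist x y \<le> dist x z + dist y z"
  proof transfer
    fix x y z :: real
    have "\<bar>(z - y) - of_int (round (z - y))\<bar> \<le> \<bar>(y - z) - of_int (round (y - z))\<bar>"
      using round_diff_minimal[of "z - y" "- round (y - z)"] by simp
    then show "\<bar>(x - y) - of_int (round (x - y))\<bar>
        \<le> \<bar>(x - z) - of_int (round (x - z))\<bar> + \<bar>(y - z) - of_int (round (y - z))\<bar>"
      using round_dist_triangle[of "x - z" "z - y"] by simp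
  qed
qed

end

lemma dist_circle_of:
  "dist (circle_of x) (circle_of y) = \<bar>(x - y) - of_int (round (x - y))\<bar>"
  by transfer simp

text \<open>The metric induces the quotient topology.\<close>

lemma open_circle_iff: "open U \<longleftrightarrow> open (circle_of -` U)"
proof
  have "dist (circle_of y) (circle_of x) \<le> dist y x" for x y
    using round_diff_minimal[of "y - x" 0] by (simp add: dist_circle_of dist_real_def)
  then have "continuous_on UNIV circle_of"
    unfolding continuous_on_iff by (meson order_le_less_trans)
  then show "open U \<Longrightarrow> open (circle_of -` U)"
    by (rule open_vimage[rotated])
next
  assume *: "open (circle_of -` U)"
  show "open U"
    unfolding open_dist
  proof
    fix p assume "p \<in> U"
    obtain x where p: "p = circle_of x"
      by (metis Quotient_abs_rep Quotient_circle)
    then obtain e where e: "e > 0" "\<And>y. dist y x < e \<Longrightarrow> circle_of y \<in> U"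
      using * \<open>p \<in> U\<close> unfolding open_dist by auto
    have "q \<in> U" if q: "dist q p < e" for q
    proof -
      obtain y where y: "q = circle_of y"
        by (metis Quotient_abs_rep Quotient_circle)
      define z where "z = y - of_int (round (y - x))"
      have "circle_of z = q"
        unfolding y z_def by (simp add: circle.abs_eq_iff)
      moreover have "dist z x < e"
        using q unfolding y p dist_circle_of z_def dist_real_def by (simp add: algebra_simps)
      ultimately show ?thesis
        using e(2) by blast
    qed
    then show "\<exists>e>0. \<forall>y. dist y p < e \<longrightarrow> y \<in> U"
      using e(1) by blast
  qed
qed

definition is_orbit :: "nat \<Rightarrow> (nat \<Rightarrow> real) \<Rightarrow> (nat \<Rightarrow> circle) \<Rightarrow> bool"
  where "is_orbit l \<alpha> x \<longleftrightarrow> (\<forall>n. x (Suc n) - x n \<in> (\<lambda>i. circle_of (\<alpha> i)) ` {1..l})"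

text \<open>The infix \<open>-\<close> on sets is set-theoretic difference, hence a separate name for the algebraic
  difference.\<close>

definition algebraic_diff :: "'a::ab_group_add set \<Rightarrow> 'a set \<Rightarrow> 'a set"
  where "algebraic_diff A B = {x - y | x y. x \<in> A \<and> y \<in> B}"

text \<open>The least number of sets of diameter at most \<open>\<delta>\<close> covering \<open>A\<close>; meaningful for totally
  bounded \<open>A\<close>, in particular for every subset of the circle. Boundedness is required explicitly
  because \<^const>\<open>diameter\<close> is unspecified on unbounded sets.\<close>

definition covering_number :: "real \<Rightarrow> 'a::metric_space set \<Rightarrow> nat"
  where "covering_number \<delta> A =
    (LEAST n. \<exists>\<U>. finite \<U> \<and> card \<U> = n \<and> A \<subseteq> \<Union>\<U> \<and> (\<forall>U\<in>\<U>. bounded U \<and> diameter U \<le> \<delta>))"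

definition lower_box_dim :: "'a::metric_space set \<Rightarrow> ereal"
  where "lower_box_dim A =
    Liminf (at_right 0) (\<lambda>\<delta>. ereal (ln (real (covering_number \<delta> A)) / - ln \<delta>))"

definition rat_scale :: "rat \<Rightarrow> real \<Rightarrow> real"
  where "rat_scale q x = of_rat q * x"

global_interpretation rat_real: vector_space rat_scale
  by unfold_locales (simp_all add: rat_scale_def of_rat_add of_rat_mult algebra_simps)

end

theory Submission
  imports Defs "Jordan_Normal_Form.Determinant"
begin

text \<open>
  Choosing a rational basis of the span of \<open>1, \<alpha>\<^sub>1, \<dots>, \<alpha>\<^sub>l\<close> and clearing denominators turns the orbit
  into a walk \<open>c\<^sub>n\<close> in \<open>\<int>\<^sup>r\<close> with bounded steps: up to a finite set of offsets, \<open>x\<^sub>n\<close> is the class of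
  \<open>c\<^sub>n \<cdot> \<tau>\<close> for a fixed vector \<open>\<tau>\<close> of reals (\<open>lattice_coding\<close>, \<open>lattice_coding_of_orbit\<close>). If some
  nonzero integer functional takes finitely many values along the walk, a coordinate can be eliminated
  (\<open>lattice_coding_reduce\<close>), so the dimension \<open>s \<le> r\<close> of the walk may be taken minimal, and then no such
  functional exists.

  The dimension bound compares the number \<open>N\<close> of sets of diameter \<open>\<delta>\<close> covering the orbit with \<open>\<delta>\<close>.
  Two times have the same colour when their orbit points lie in the same covering set with the same offset. The walk
  induces a graph on the colours, and each closed path in this graph splits into closed paths of length at
  most \<open>N\<close>. A short closed path has a displacement \<open>d \<in> \<int>\<^sup>s\<close> of size \<open>O(N)\<close> for which \<open>d \<cdot> \<tau>\<close> is within
  \<open>O(N \<delta>)\<close> of an integer. A functional that kills all these \<open>d\<close> would be a function of the colour, so it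
  would take finitely many values along the walk; by minimality of \<open>s\<close> the vectors \<open>d\<close> therefore span.
  Cramer's rule for \<open>s\<close> independent ones yields \<open>q = O(N\<^sup>s)\<close> and an integer vector \<open>p\<close> such that every entry of
  \<open>\<theta> = q \<tau> - p\<close> is \<open>O(N\<^sup>s \<delta>)\<close> (\<open>simultaneous_approximation\<close>). Now \<open>w\<^sub>n = c\<^sub>n \<cdot> \<theta>\<close> is a real lift of the
  sequence \<open>q (c\<^sub>n \<cdot> \<tau>)\<close> on the circle that moves in steps of size \<open>O(N\<^sup>s \<delta>)\<close>, while its points on the circle are
  covered by \<open>O(N)\<close> sets of that size. So either \<open>N\<^sup>s\<^sup>+\<^sup>1 \<delta>\<close> is bounded below, or the circle has an
  uncovered gap that is too wide to jump over and \<open>w\<close> is bounded. If the second case occurs for a single \<open>\<delta>\<close>, fix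
  that \<open>\<theta>\<close>, which is nonzero because the orbit is infinite. The whole argument can then be repeated at every scale
  with \<open>c\<^sub>n \<cdot> \<theta>\<close> in place of \<open>c\<^sub>n \<cdot> \<tau>\<close> and without reduction modulo 1; it bounds the fixed nonzero vector
  \<open>\<theta>\<close> by \<open>O(N\<^sup>s \<delta>)\<close>, which is even better. In both cases \<open>N\<^sup>s\<^sup>+\<^sup>1 \<delta>\<close> is bounded below for all \<open>\<delta>\<close>
  (\<open>covering_number_power_ge\<close>), and the lower box dimension is at least \<open>1 / (s + 1)\<close>.

  For \<open>r = 1\<close> the walk is an unbounded integer walk with bounded steps, so finitely many translates of the
  closure \<open>K\<close> of the orbit contain a half-orbit of an irrational rotation and hence cover the circle; one of them, and thus
  \<open>K\<close>, has interior (\<open>lattice_coding_1_interior\<close>).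

  For two steps \<open>\<alpha>, \<beta>\<close> with \<open>1, \<alpha>, \<beta>\<close> rationally independent, put \<open>\<gamma> = \<beta> - \<alpha>\<close> and write
  \<open>x\<^sub>n = x\<^sub>0 + n \<alpha> + b\<^sub>n \<gamma>\<close>. For fixed \<open>m\<close>, the integer \<open>b\<^sub>n\<^sub>+\<^sub>m - b\<^sub>n\<close> changes by at most 1 when \<open>n\<close> increases, so it
  takes all values between any two of its values. If the spread of these values is unbounded in \<open>m\<close>, then
  \<open>K - K\<close> contains arbitrarily long pieces of orbits of the irrational rotation by \<open>\<gamma>\<close> and is everything. Otherwise
  \<open>b\<^sub>n = n \<theta> + O(1)\<close> for some \<open>\<theta>\<close>, finitely many translates of \<open>K\<close> contain the sequence
  \<open>n \<alpha> + \<lfloor>n \<theta>\<rfloor> \<gamma>\<close>, and the closure of this sequence has interior by Kronecker's theorem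
  (\<open>floor_sequence_interior\<close>). When \<open>1, \<alpha>, \<beta>\<close> are dependent, \<open>r = 1\<close> and \<open>K\<close> has interior. If \<open>K - K\<close> is the whole
  circle, the differences of \<open>N\<close> covering sets cover it, so \<open>N\<^sup>2\<close> is at least of order \<open>1 / \<delta>\<close> and the
  dimension is at least \<open>1/2\<close>.
\<close>

section \<open>The circle as a topological group\<close>

lemma circle_of_add: "circle_of (a + b) = circle_of a + circle_of b"
  by (simp add: plus_circle.abs_eq)

lemma circle_of_diff: "circle_of (a - b) = circle_of a - circle_of b"
  by (simp add: minus_circle.abs_eq)

lemma circle_of_minus: "circle_of (- a) = - circle_of a"
  by (simp add: uminus_circle.abs_eq)

lemma circle_of_eq_iff: "circle_of a = circle_of b \<longleftrightarrow> a - b \<in> \<int>"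
  by (simp add: circle.abs_eq_iff)

lemma circle_of_surj: obtains t where "p = circle_of t"
  by (metis Quotient_abs_rep Quotient_circle)

lemma circle_of_frac: "circle_of (frac t) = circle_of t"
  by (simp add: circle_of_eq_iff frac_def)

lemma dist_circle_of_le: "dist (circle_of a) (circle_of b) \<le> \<bar>a - b - of_int k\<bar>"
  using round_diff_minimal[of "a - b" k] by (simp add: dist_circle_of)

lemma dist_circle_of_le_abs: "dist (circle_of a) (circle_of b) \<le> \<bar>a - b\<bar>"
  using dist_circle_of_le[of a b 0] by simp

lemma dist_circle_of_eq:
  assumes "\<bar>a - b\<bar> < 1 / 2"
  shows "dist (circle_of a) (circle_of b) = \<bar>a - b\<bar>"
proof -
  have "round (a - b) = 0"
    using assms by (intro round_unique) linarith+
  then show ?thesis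
    by (simp add: dist_circle_of)
qed

lemma dist_circle_zero: "dist p q = dist (p - q) (0 :: circle)"
  by (metis circle_of_surj circle_of_diff dist_circle_of diff_zero zero_circle_def)

lemma dist_circle_cancel: "dist (p + r) (q + r) = dist p (q :: circle)"
  by (metis add_diff_cancel_right dist_circle_zero)

lemma dist_circle_minus: "dist (- p) (- q) = dist p (q :: circle)"
  by (metis dist_circle_zero dist_commute minus_diff_minus minus_diff_eq)

lemma dist_circle_diff_le: "dist (a - b) (c - d) \<le> dist a c + dist b (d :: circle)"
proof -
  have "dist (a - b) (c - d) \<le> dist (a + - b) (c + - b) + dist (- b + c) (- d + c)"
    using dist_triangle[of "a - b" "c - d" "c - b"] by (simp add: add.commute)
  then show ?thesis
    by (simp only: dist_circle_cancel dist_circle_minus)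
qed

lemma continuous_on_circle_of: "continuous_on S circle_of"
  unfolding continuous_on_iff
  by (metis dist_circle_of_le_abs dist_real_def order_le_less_trans)

lemma compact_circle: "compact (UNIV :: circle set)"
proof -
  have "circle_of ` {0..1} = UNIV"
  proof (intro equalityI subsetI)
    fix p :: circle
    obtain t where "p = circle_of t" by (rule circle_of_surj)
    then have "p = circle_of (frac t)" by (simp add: circle_of_frac)
    moreover have "frac t \<in> {0..1}" by (simp add: frac_lt_1 less_imp_le)
    ultimately show "p \<in> circle_of ` {0..1}" by blast
  qed simp
  then show ?thesis
    by (metis compact_continuous_image[OF continuous_on_circle_of] compact_Icc)
qed

lemma continuous_on_translate: "continuous_on S (\<lambda>p. p + (g :: circle))"
  unfolding continuous_on_iff by (auto simp: dist_circle_cancel)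

lemma translate_eq_vimage: "(\<lambda>p. p + g) ` A = (\<lambda>p. p - g) -` (A :: circle set)"
  by (force simp: image_iff)

lemma open_translate:
  assumes "open (A :: circle set)"
  shows "open ((\<lambda>p. p + g) ` A)"
  unfolding translate_eq_vimage
  using open_vimage[OF assms continuous_on_translate[of UNIV "- g"]] by simp

lemma closed_translate:
  assumes "closed (A :: circle set)"
  shows "closed ((\<lambda>p. p + g) ` A)"
  unfolding translate_eq_vimage
  using closed_vimage[OF assms continuous_on_translate[of UNIV "- g"]] by simp

lemma interior_translate_nonempty:
  assumes "interior ((\<lambda>p. p + g) ` (A :: circle set)) \<noteq> {}"
  shows "interior A \<noteq> {}"
proof -
  let ?U = "(\<lambda>p. p + - g) ` interior ((\<lambda>p. p + g) ` A)"
  have "?U \<subseteq> A"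
    using interior_subset[of "(\<lambda>p. p + g) ` A"] by auto
  then have "?U \<subseteq> interior A"
    by (rule interior_maximal) (rule open_translate[OF open_interior])
  then show ?thesis
    using assms by blast
qed

text \<open>A finite union of closed sets without interior has no interior. This is how statements about
  \<open>K\<close> up to finitely many translates come back to \<open>K\<close> itself.\<close>

lemma interior_finite_translates:
  fixes A :: "circle set"
  assumes "finite G" "closed A" "interior (\<Union>g\<in>G. (\<lambda>p. p + g) ` A) \<noteq> {}"
  shows "interior A \<noteq> {}"
  using assms(1,3)
proof (induction G rule: finite_induct)
  case empty
  then show ?case by simp
next
  case (insert g G)
  show ?case
  proof
    assume "interior A = {}"
    then have "interior ((\<lambda>p. p + g) ` A) = {}"
      using interior_translate_nonempty by blast
    moreover have "closed (\<Union>g\<in>G. (\<lambda>p. p + g) ` A)"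
      using insert.hyps(1) closed_translate[OF assms(2)] by blast
    ultimately have "interior ((\<Union>g\<in>G. (\<lambda>p. p + g) ` A) \<union> (\<lambda>p. p + g) ` A)
        = interior (\<Union>g\<in>G. (\<lambda>p. p + g) ` A)"
      by (rule interior_closed_Un_empty_interior[rotated])
    then show False
      using insert.IH insert.prems \<open>interior A = {}\<close> by (simp add: Un_commute)
  qed
qed

text \<open>The projection is an open map: the preimage of the image of an interval is the union of its integer
  translates.\<close>

lemma circle_of_arc_interior:
  assumes "a < b" "circle_of ` {a<..<b} \<subseteq> A"
  shows "interior A \<noteq> {}"
proof -
  have "open (circle_of ` {a<..<b})"
    unfolding open_circle_iff
  proof -
    have "circle_of -` (circle_of ` {a<..<b}) = (\<Union>k::int. (+) (of_int k) ` {a<..<b})"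
    proof (intro equalityI subsetI)
      fix t assume "t \<in> circle_of -` (circle_of ` {a<..<b})"
      then obtain u where u: "u \<in> {a<..<b}" "t - u \<in> \<int>"
        by (auto simp: circle_of_eq_iff)
      then obtain k where "t = of_int k + u"
        by (metis Ints_cases add_diff_cancel_left' diff_add_cancel add.commute)
      then show "t \<in> (\<Union>k::int. (+) (of_int k) ` {a<..<b})"
        using u(1) by blast
    next
      fix t assume "t \<in> (\<Union>k::int. (+) (of_int k) ` {a<..<b})"
      then obtain k :: int and u where u: "u \<in> {a<..<b}" "t = of_int k + u"
        by blast
      then have "circle_of t = circle_of u"
        by (simp add: circle_of_eq_iff)
      then show "t \<in> circle_of -` (circle_of ` {a<..<b})"
        using u(1) by auto
    qed
    then show "open (circle_of -` (circle_of ` {a<..<b}))"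
      by (simp only:) (intro open_UN ballI open_translation open_greaterThanLessThan)
  qed
  then have "circle_of ` {a<..<b} \<subseteq> interior A"
    using assms(2) by (rule interior_maximal[rotated])
  then show ?thesis
    using assms(1) by (metis dense greaterThanLessThan_iff image_eqI empty_iff subsetD)
qed

section \<open>Covering numbers and box dimension\<close>

text \<open>The circle is totally bounded, so some finite cover exists and the \<open>LEAST\<close> in the definition is attained.\<close>

lemma covering_number_witness:
  fixes A :: "circle set"
  assumes "\<delta> > 0"
  obtains \<U> where "finite \<U>" "card \<U> = covering_number \<delta> A" "A \<subseteq> \<Union>\<U>"
    "\<And>U p q. \<lbrakk>U \<in> \<U>; p \<in> U; q \<in> U\<rbrakk> \<Longrightarrow> dist p q \<le> \<delta>"
proof -
  let ?P = "\<lambda>n. \<exists>\<U>. finite \<U> \<and> card \<U> = n \<and> A \<subseteq> \<Union>\<U> \<and> (\<forall>U\<in>\<U>. bounded U \<and> diameter U \<le> \<delta>)"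
  obtain D where D: "finite D" "(UNIV :: circle set) \<subseteq> (\<Union>p\<in>D. ball p (\<delta> / 2))"
    using compact_circle assms
    by (metis (no_types, lifting) compactE_image UNIV_I centre_in_ball half_gt_zero open_ball UN_I subsetI)
  have "bounded (ball p (\<delta> / 2)) \<and> diameter (ball p (\<delta> / 2)) \<le> \<delta>" for p :: circle
  proof
    have "dist x y \<le> \<delta>" if "x \<in> ball p (\<delta> / 2)" "y \<in> ball p (\<delta> / 2)" for x y
      using dist_triangle3[of x y p] that by simp
    moreover have "p \<in> ball p (\<delta> / 2)"
      using assms by simp
    ultimately show "diameter (ball p (\<delta> / 2)) \<le> \<delta>"
      unfolding diameter_def by (auto intro!: cSUP_least)
  qed simp
  then have "\<exists>n. ?P n"
    using D by (intro exI[of _ "card ((\<lambda>p. ball p (\<delta> / 2)) ` D)"] exI[of _ "(\<lambda>p. ball p (\<delta> / 2)) ` D"]) auto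
  then have "?P (covering_number \<delta> A)"
    unfolding covering_number_def by (rule LeastI_ex)
  then obtain \<U> where \<U>: "finite \<U>" "card \<U> = covering_number \<delta> A" "A \<subseteq> \<Union>\<U>"
    "\<And>U. U \<in> \<U> \<Longrightarrow> bounded U \<and> diameter U \<le> \<delta>"
    by blast
  show ?thesis
  proof (rule that[OF \<U>(1-3)])
    fix U p q assume "U \<in> \<U>" "p \<in> U" "q \<in> U"
    then show "dist p q \<le> \<delta>"
      using \<U>(4) diameter_bounded_bound order_trans by blast
  qed
qed

text \<open>Among \<open>card \<U> + 1\<close> equally spaced points of the arc two would lie in the same covering set if the spacing
  exceeded \<open>\<delta>\<close>. Arcs of length at most \<open>1/2\<close> have their circle distances equal to the distances
  on the line.\<close>

lemma card_cover_of_arc: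
  fixes \<U> :: "circle set set"
  assumes "finite \<U>" "circle_of ` {a..<a + \<eta>} \<subseteq> \<Union>\<U>" "0 < \<eta>" "\<eta> \<le> 1 / 2" "\<delta> > 0"
    and "\<And>U p q. \<lbrakk>U \<in> \<U>; p \<in> U; q \<in> U\<rbrakk> \<Longrightarrow> dist p q \<le> \<delta>"
  shows "\<eta> \<le> (real (card \<U>) + 1) * \<delta>"
proof (rule ccontr)
  assume "\<not> ?thesis"
  then have less: "(real (card \<U>) + 1) * \<delta> < \<eta>" by simp
  define M where "M = card \<U> + 1"
  define t where "t i = a + real i * (\<eta> / real M)" for i
  have M: "real M > 0" "\<delta> < \<eta> / real M"
    using less by (auto simp: M_def field_simps)
  have "\<exists>U\<in>\<U>. circle_of (t i) \<in> U" if "i < M" for i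
  proof -
    have "real i * \<eta> < \<eta> * real M"
      using that assms(3) by (simp add: mult.commute)
    then have "t i \<in> {a..<a + \<eta>}"
      using assms(3) M(1) by (simp add: t_def pos_divide_less_eq)
    then show ?thesis
      using assms(2) by blast
  qed
  then have "\<forall>i\<in>{..<M}. \<exists>U. U \<in> \<U> \<and> circle_of (t i) \<in> U"
    by blast
  then obtain u where "\<forall>i\<in>{..<M}. u i \<in> \<U> \<and> circle_of (t i) \<in> u i"
    by (rule bchoice[THEN exE])
  then have u: "\<And>i. i < M \<Longrightarrow> u i \<in> \<U> \<and> circle_of (t i) \<in> u i"
    by blast
  have "\<not> inj_on u {..<M}"
    using card_inj_on_le[of u "{..<M}" \<U>] u assms(1) by (auto simp: M_def)
  then obtain i j where ij: "i < j" "j < M" "u i = u j"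
    using linorder_inj_onI'[of "{..<M}" u] by auto
  have le: "dist (circle_of (t j)) (circle_of (t i)) \<le> \<delta>"
    using u[of i] u[of j] ij assms(6) by auto
  have tt: "t j - t i = real (j - i) * (\<eta> / real M)"
    using ij by (simp add: t_def left_diff_distrib of_nat_diff diff_divide_distrib)
  have "real (j - i) * \<eta> < real M * \<eta>"
    using ij(2) assms(3) by (intro mult_strict_right_mono) auto
  then have "real (j - i) * (\<eta> / real M) < \<eta>"
    using M(1) by (simp add: pos_divide_less_eq mult.commute)
  moreover have "0 \<le> real (j - i) * (\<eta> / real M)"
    using assms(3) by simp
  ultimately have "\<bar>t j - t i\<bar> < 1 / 2"
    using assms(4) unfolding tt by linarith
  then have "dist (circle_of (t j)) (circle_of (t i)) = real (j - i) * (\<eta> / real M)"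
    using assms(3) by (simp add: dist_circle_of_eq tt)
  moreover have "1 * (\<eta> / real M) \<le> real (j - i) * (\<eta> / real M)"
    using ij assms(3) by (intro mult_right_mono) auto
  ultimately show False
    using M le by simp
qed

text \<open>Taking logarithms in the hypothesis bounds the quotient in the definition below by
  \<open>1/k + O(1 / -ln \<delta>)\<close>.\<close>

lemma lower_box_dim_ge:
  fixes A :: "'a::metric_space set"
  assumes "c > 0" "k > 0" "\<And>\<delta>. \<lbrakk>0 < \<delta>; \<delta> < 1\<rbrakk> \<Longrightarrow> c \<le> real (covering_number \<delta> A) ^ k * \<delta>"
  shows "lower_box_dim A \<ge> ereal (1 / real k)"
proof -
  let ?f = "\<lambda>\<delta>::real. 1 / real k + ln c / real k * inverse (- ln \<delta>)"
  have "((\<lambda>\<delta>::real. inverse (- ln \<delta>)) \<longlongrightarrow> 0) (at_right 0)"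
    using ln_at_0 by (intro tendsto_inverse_0_at_top) (simp add: filterlim_uminus_at_bot)
  then have "(?f \<longlongrightarrow> 1 / real k + ln c / real k * 0) (at_right 0)"
    by (intro tendsto_intros)
  then have "((\<lambda>\<delta>. ereal (?f \<delta>)) \<longlongrightarrow> ereal (1 / real k)) (at_right 0)"
    by simp
  then have "Liminf (at_right 0) (\<lambda>\<delta>. ereal (?f \<delta>)) = ereal (1 / real k)"
    by (rule lim_imp_Liminf[rotated]) simp
  moreover have "Liminf (at_right 0) (\<lambda>\<delta>. ereal (?f \<delta>)) \<le> lower_box_dim A"
    unfolding lower_box_dim_def
  proof (rule Liminf_mono)
    have "eventually (\<lambda>\<delta>::real. \<delta> \<in> {0<..<1}) (at_right 0)"
      by (rule eventually_at_right_real) simp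
    then show "eventually (\<lambda>\<delta>. ereal (?f \<delta>) \<le> ereal (ln (real (covering_number \<delta> A)) / - ln \<delta>)) (at_right 0)"
    proof eventually_elim
      case (elim \<delta>)
      let ?N = "real (covering_number \<delta> A)"
      have le: "c \<le> ?N ^ k * \<delta>"
        using assms(3) elim by simp
      \<comment> \<open>\<open>ln 0 = 0\<close>, so an empty covering has to be excluded before taking logarithms\<close>
      have "?N \<noteq> 0"
        using le assms(1,2) by (intro notI) (simp add: power_0_left)
      then have N: "?N > 0" by simp
      have "ln c \<le> ln (?N ^ k * \<delta>)"
        using le assms(1) by (intro ln_mono) auto
      also have "\<dots> = real k * ln ?N + ln \<delta>"
        using N elim by (simp add: ln_mult ln_realpow)
      finally have *: "ln c - ln \<delta> \<le> real k * ln ?N" by simp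
      have "ln \<delta> < 0" using elim by simp
      then have "?f \<delta> = (ln c - ln \<delta>) / (real k * - ln \<delta>)"
        using assms(2) by (simp add: field_simps)
      also have "\<dots> \<le> (real k * ln ?N) / (real k * - ln \<delta>)"
        using * \<open>ln \<delta> < 0\<close> assms(2) by (intro divide_right_mono) (auto intro: mult_nonneg_nonpos)
      also have "\<dots> = ln ?N / - ln \<delta>"
        using assms(2) by simp
      finally show ?case by simp
    qed
  qed
  ultimately show ?thesis by simp
qed

section \<open>Integer matrices with small entries\<close>

lemma abs_det_le:
  fixes A :: "int mat"
  assumes "A \<in> carrier_mat n n" "\<And>i j. \<lbrakk>i < n; j < n\<rbrakk> \<Longrightarrow> \<bar>A $$ (i, j)\<bar> \<le> M"
  shows "\<bar>det A\<bar> \<le> fact n * M ^ n"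
proof -
  let ?S = "{p. p permutes {0..<n}}"
  have "\<bar>det A\<bar> \<le> (\<Sum>p\<in>?S. \<bar>signof p * (\<Prod>i = 0..<n. A $$ (i, p i))\<bar>)"
    unfolding det_def'[OF assms(1)] by (rule sum_abs)
  also have "\<dots> \<le> (\<Sum>p\<in>?S. M ^ n)"
  proof (rule sum_mono)
    fix p assume "p \<in> ?S"
    then have p: "p i < n" if "i < n" for i
      using that permutes_in_image[of p "{0..<n}" i] by auto
    have "\<bar>signof p * (\<Prod>i = 0..<n. A $$ (i, p i))\<bar> = (\<Prod>i = 0..<n. \<bar>A $$ (i, p i)\<bar>)"
      by (simp add: abs_mult abs_prod sign_def)
    also have "\<dots> \<le> (\<Prod>i = 0..<n. M)"
      using assms(2) p by (intro prod_mono) auto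
    finally show "\<bar>signof p * (\<Prod>i = 0..<n. A $$ (i, p i))\<bar> \<le> M ^ n"
      by simp
  qed
  also have "\<dots> = fact n * M ^ n"
    using card_permutations[of "{0..<n}" n] by simp
  finally show ?thesis .
qed

lemma abs_cofactor_le:
  fixes A :: "int mat"
  assumes "A \<in> carrier_mat n n" "\<And>i j. \<lbrakk>i < n; j < n\<rbrakk> \<Longrightarrow> \<bar>A $$ (i, j)\<bar> \<le> M" "i < n" "j < n"
  shows "\<bar>cofactor A i j\<bar> \<le> fact (n - 1) * M ^ (n - 1)"
proof -
  have "\<bar>det (mat_delete A i j)\<bar> \<le> fact (n - 1) * M ^ (n - 1)"
  proof (rule abs_det_le)
    show "mat_delete A i j \<in> carrier_mat (n - 1) (n - 1)"
      using assms(1) by (rule mat_delete_carrier)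
  next
    fix i' j' assume "i' < n - 1" "j' < n - 1"
    then show "\<bar>mat_delete A i j $$ (i', j')\<bar> \<le> M"
      using assms unfolding mat_delete_def by auto
  qed
  then show ?thesis
    unfolding cofactor_def by (simp add: abs_mult power_abs)
qed

text \<open>Replace as many rows of the identity matrix as possible by elements of \<open>\<A>\<close> while keeping the determinant
  nonzero. If a row \<open>k\<close> remains, the cofactors along this row do not depend on its entries, so the
  determinant is a functional of that row: nonzero, and zero on \<open>\<A>\<close> by maximality.\<close>

lemma annihilator_or_nonsingular:
  fixes \<A> :: "(nat \<Rightarrow> int) set"
  obtains (annihilator) u j where "j < n" "u j \<noteq> 0" "\<And>d. d \<in> \<A> \<Longrightarrow> (\<Sum>j<n. u j * d j) = 0"
  | (nonsingular) D where "\<And>i. i < n \<Longrightarrow> D i \<in> \<A>" "det (mat n n (\<lambda>(i, j). D i j)) \<noteq> 0"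
proof -
  define M :: "(nat \<Rightarrow> nat \<Rightarrow> int) \<Rightarrow> int mat" where "M D = mat n n (\<lambda>(i, j). D i j)" for D
  define good where "good k \<longleftrightarrow> k \<le> n \<and> (\<exists>D. (\<forall>i<k. D i \<in> \<A>) \<and> det (M D) \<noteq> 0)" for k
  have M: "M D \<in> carrier_mat n n" for D
    by (simp add: M_def)
  have "M (\<lambda>i j. if i = j then 1 else 0) = 1\<^sub>m n"
    by (auto simp: M_def)
  then have "good 0"
    by (auto simp: good_def intro!: exI[of _ "\<lambda>i j. if i = j then 1 else 0"])
  then obtain k where k: "good k" "\<And>k'. good k' \<Longrightarrow> k' \<le> k"
    using GreatestI_nat[of good 0 n] Greatest_le_nat[of good _ n] good_def by blast
  then obtain D where D: "\<And>i. i < k \<Longrightarrow> D i \<in> \<A>" "det (M D) \<noteq> 0" "k \<le> n"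
    by (auto simp: good_def)
  show thesis
  proof (cases "k = n")
    case True
    then show thesis
      using D nonsingular[of D] unfolding M_def by blast
  next
    case False
    then have "k < n"
      using D(3) by simp
    have expand: "det (M (D(k := d))) = (\<Sum>j<n. cofactor (M D) k j * d j)" for d
    proof -
      have "mat_delete (M (D(k := d))) k j = mat_delete (M D) k j" for j
        by (rule eq_matI) (auto simp: M_def mat_delete_def)
      then show ?thesis
        using laplace_expansion_row[OF M \<open>k < n\<close>, of "D(k := d)"] \<open>k < n\<close>
        by (simp add: M_def cofactor_def mult.commute)
    qed
    have "(\<Sum>j<n. cofactor (M D) k j * D k j) \<noteq> 0"
      using expand[of "D k"] D(2) by simp
    then obtain j where "j < n" "cofactor (M D) k j \<noteq> 0"
      by (metis (no_types, lifting) lessThan_iff mult_zero_left sum.neutral)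
    moreover have "(\<Sum>j<n. cofactor (M D) k j * d j) = 0" if "d \<in> \<A>" for d
    proof (rule ccontr)
      assume "(\<Sum>j<n. cofactor (M D) k j * d j) \<noteq> 0"
      then have "good (Suc k)"
        using D(1) that \<open>k < n\<close> unfolding good_def
        by (intro conjI exI[of _ "D(k := d)"]) (auto simp: expand less_Suc_eq)
      then show False
        using k(2) by fastforce
    qed
    ultimately show thesis
      using annihilator by blast
  qed
qed

text \<open>This is Cramer's rule, \<open>adj A * A = det A\<close>, applied to \<open>\<theta>\<close>: the numbers \<open>q \<theta>\<^sub>j\<close> with \<open>q = det A\<close> are
  integer combinations of the values of the rows on \<open>\<theta>\<close>. The coefficients do not involve \<open>\<theta>\<close>, so approximate
  values of the rows give approximate values of \<open>q \<theta>\<^sub>j\<close>.\<close>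

lemma det_scaled_coordinate:
  fixes D :: "nat \<Rightarrow> nat \<Rightarrow> int" and \<theta> :: "nat \<Rightarrow> real"
  assumes "j < n"
  defines "A \<equiv> mat n n (\<lambda>(i, j). D i j)"
  shows "of_int (det A) * \<theta> j = (\<Sum>i<n. of_int (cofactor A i j) * (\<Sum>k<n. of_int (D i k) * \<theta> k))"
proof -
  have A: "A \<in> carrier_mat n n"
    by (simp add: A_def)
  have *: "(\<Sum>i<n. cofactor A i j * D i k) = (if j = k then det A else 0)" if "k < n" for k
  proof -
    have "(\<Sum>i<n. cofactor A i j * D i k) = (adj_mat A * A) $$ (j, k)"
      using assms(1) that by (simp add: A_def adj_mat_def scalar_prod_def atLeast0LessThan)
    also have "\<dots> = (det A \<cdot>\<^sub>m 1\<^sub>m n) $$ (j, k)"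
      using adj_mat(3)[OF A] by simp
    finally show ?thesis
      using assms(1) that by (cases "j = k") simp_all
  qed
  have "(\<Sum>i<n. of_int (cofactor A i j) * (\<Sum>k<n. of_int (D i k) * \<theta> k))
      = (\<Sum>k<n. \<Sum>i<n. of_int (cofactor A i j) * (of_int (D i k) * \<theta> k))"
    unfolding sum_distrib_left by (rule sum.swap)
  also have "\<dots> = (\<Sum>k<n. of_int (\<Sum>i<n. cofactor A i j * D i k) * \<theta> k)"
    by (simp add: sum_distrib_right mult.assoc)
  also have "\<dots> = (\<Sum>k<n. if j = k then of_int (det A) * \<theta> k else 0)"
    by (intro sum.cong) (simp_all add: *)
  also have "\<dots> = of_int (det A) * \<theta> j"
    using assms(1) by simp
  finally show ?thesis by simp
qed

lemma bounded_cramer: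
  fixes \<A> :: "(nat \<Rightarrow> int) set" and M n :: nat
  assumes "\<And>d j. \<lbrakk>d \<in> \<A>; j < n\<rbrakk> \<Longrightarrow> \<bar>d j\<bar> \<le> int M"
    and "\<And>u j. \<lbrakk>j < n; u j \<noteq> 0\<rbrakk> \<Longrightarrow> \<exists>d\<in>\<A>. (\<Sum>j<n. u j * d j) \<noteq> 0"
  obtains q :: int and D B :: "nat \<Rightarrow> nat \<Rightarrow> int" where "q \<noteq> 0" "\<bar>q\<bar> \<le> int (fact n * M ^ n)"
    "\<And>i. i < n \<Longrightarrow> D i \<in> \<A>"
    "\<And>i j. \<lbrakk>i < n; j < n\<rbrakk> \<Longrightarrow> \<bar>B j i\<bar> \<le> int (fact (n - 1) * M ^ (n - 1))"
    "\<And>(\<theta> :: nat \<Rightarrow> real) j. j < n \<Longrightarrow>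
      of_int q * \<theta> j = (\<Sum>i<n. of_int (B j i) * (\<Sum>k<n. of_int (D i k) * \<theta> k))"
proof (cases rule: annihilator_or_nonsingular[of n \<A>])
  case (annihilator u j)
  then show thesis
    using assms(2) by blast
next
  case (nonsingular D)
  define A where "A = mat n n (\<lambda>(i, j). D i j)"
  have A: "A \<in> carrier_mat n n" "\<bar>A $$ (i, j)\<bar> \<le> int M" if "i < n" "j < n" for i j
    using assms(1) nonsingular(1) that by (simp_all add: A_def)
  have A': "A \<in> carrier_mat n n"
    by (simp add: A_def)
  show thesis
  proof (rule that[of "det A" D "\<lambda>j i. cofactor A i j"])
    show "det A \<noteq> 0"
      using nonsingular(2) by (simp add: A_def)
    show "\<bar>det A\<bar> \<le> int (fact n * M ^ n)"
      using abs_det_le[OF A' A(2)] by simp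
    show "\<bar>cofactor A i j\<bar> \<le> int (fact (n - 1) * M ^ (n - 1))" if "i < n" "j < n" for i j
      using abs_cofactor_le[OF A' A(2) that] by simp
    show "of_int (det A) * \<theta> j
        = (\<Sum>i<n. of_int (cofactor A i j) * (\<Sum>k<n. of_int (D i k) * \<theta> k))"
      if "j < n" for \<theta> :: "nat \<Rightarrow> real" and j
      using det_scaled_coordinate[OF that] by (simp add: A_def)
  qed (use nonsingular(1) in auto)
qed

section \<open>Closed walks in a colour graph\<close>

text \<open>A path in the graph whose vertices are the colours and whose edges are the steps from time \<open>n\<close> to time
  \<open>n + 1\<close>. It is recorded by its edges, that is, by the list \<open>ns\<close> of their times. These times need not be
  consecutive: between two steps the path may jump to another time of the same colour.\<close>

primrec color_walk :: "(nat \<Rightarrow> 'c) \<Rightarrow> 'c \<Rightarrow> nat list \<Rightarrow> 'c \<Rightarrow> bool" where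
  "color_walk a p [] q \<longleftrightarrow> p = q"
| "color_walk a p (n # ns) q \<longleftrightarrow> a n = p \<and> color_walk a (a (Suc n)) ns q"

definition displacement :: "(nat \<Rightarrow> nat \<Rightarrow> int) \<Rightarrow> nat list \<Rightarrow> nat \<Rightarrow> int" where
  "displacement c ns j = (\<Sum>n\<leftarrow>ns. c (Suc n) j - c n j)"

lemma color_walk_append:
  "color_walk a p (ns @ ms) q \<longleftrightarrow> (\<exists>r. color_walk a p ns r \<and> color_walk a r ms q)"
  by (induction ns arbitrary: p) auto

lemma color_walk_upt: "color_walk a (a m) [m..<m + k] (a (m + k))"
  by (induction k) (auto simp: color_walk_append)

lemma displacement_upt: "displacement c [m..<m + k] j = c (m + k) j - c m j"
  by (induction k) (auto simp: displacement_def)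

lemma displacement_append: "displacement c (ns @ ms) j = displacement c ns j + displacement c ms j"
  by (simp add: displacement_def)

lemma abs_displacement_le:
  assumes "\<And>n. \<bar>c (Suc n) j - c n j\<bar> \<le> int P"
  shows "\<bar>displacement c ns j\<bar> \<le> int (length ns * P)"
proof (induction ns)
  case (Cons n ns)
  then show ?case
    using assms[of n] by (simp add: displacement_def)
qed (simp add: displacement_def)

text \<open>A closed path longer than the number of colours leaves some colour twice and can be cut there into two
  shorter closed paths.\<close>

lemma closed_walk_induct [consumes 2, case_names short append]:
  assumes "color_walk a p ns p" "finite (range a)"
    and short: "\<And>p ns. \<lbrakk>color_walk a p ns p; length ns \<le> card (range a)\<rbrakk> \<Longrightarrow> Q ns"
    and append: "\<And>us vs ws. \<lbrakk>Q (us @ ws); Q vs\<rbrakk> \<Longrightarrow> Q (us @ vs @ ws)"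
  shows "Q ns"
  using assms(1)
proof (induction "length ns" arbitrary: ns p rule: less_induct)
  case less
  show ?case
  proof (cases "length ns \<le> card (range a)")
    case True
    then show ?thesis
      using less.prems short by blast
  next
    case False
    have "\<not> distinct (map a ns)"
    proof
      assume "distinct (map a ns)"
      then have "length ns = card (set (map a ns))"
        using distinct_card by force
      also have "\<dots> \<le> card (range a)"
        using assms(2) by (intro card_mono) auto
      finally show False
        using False by simp
    qed
    then obtain xs ys zs b where "map a ns = xs @ [b] @ ys @ [b] @ zs"
      by (meson not_distinct_decomp)
    then obtain us n vs m ws where ns: "ns = us @ (n # vs) @ (m # ws)" "a n = a m"
      by (auto simp: map_eq_append_conv map_eq_Cons_conv append_eq_map_conv Cons_eq_map_conv)
    have walks: "color_walk a p (us @ (m # ws)) p" "color_walk a (a n) (n # vs) (a n)"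
      using less.prems ns(2) unfolding ns(1) by (auto simp: color_walk_append)
    have "Q (us @ (m # ws))" "Q (n # vs)"
      using less.hyps[OF _ walks(1)] less.hyps[OF _ walks(2)] by (simp_all add: ns(1))
    then show ?thesis
      unfolding ns(1) by (rule append)
  qed
qed

text \<open>Along a path of colours the sum of the actual displacements differs from the difference of the values at the end points only
  through the jumps between times of equal colour, each of which costs at most \<open>\<delta>\<close>. The subgroup \<open>G\<close>
  of \<open>\<real>\<close> is \<open>\<int>\<close> for points on the circle and trivial for points on the line.\<close>

lemma color_walk_drift:
  fixes c :: "nat \<Rightarrow> nat \<Rightarrow> int" and \<tau> :: "nat \<Rightarrow> real" and G :: "real set" and s :: nat
  defines "y \<equiv> \<lambda>n. \<Sum>j<s. of_int (c n j) * \<tau> j"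
  assumes G: "0 \<in> G" "\<And>g h. \<lbrakk>g \<in> G; h \<in> G\<rbrakk> \<Longrightarrow> g - h \<in> G"
    and close: "\<And>m n. a m = a n \<Longrightarrow> \<exists>g\<in>G. \<bar>y m - y n - g\<bar> \<le> \<delta>"
    and "color_walk a p ns q" "a m = p" "a n = q"
  shows "\<exists>g\<in>G. \<bar>(\<Sum>j<s. of_int (displacement c ns j) * \<tau> j) - (y n - y m) - g\<bar>
    \<le> (real (length ns) + 1) * \<delta>"
  using assms(5-)
proof (induction ns arbitrary: p m)
  case Nil
  then have "a m = a n" by simp
  then show ?case
    using close[of m n] by (simp add: displacement_def)
next
  case (Cons i ns)
  obtain g where g: "g \<in> G" "\<bar>(\<Sum>j<s. of_int (displacement c ns j) * \<tau> j) - (y n - y (Suc i)) - g\<bar>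
    \<le> (real (length ns) + 1) * \<delta>"
    using Cons.IH[of "a (Suc i)" "Suc i"] Cons.prems by auto
  have "a i = a m"
    using Cons.prems by simp
  then obtain h where h: "h \<in> G" "\<bar>y i - y m - h\<bar> \<le> \<delta>"
    using close by blast
  have "(\<Sum>j<s. of_int (displacement c (i # ns) j) * \<tau> j)
      = (y (Suc i) - y i) + (\<Sum>j<s. of_int (displacement c ns j) * \<tau> j)"
    by (simp add: displacement_def y_def algebra_simps sum.distrib sum_subtractf)
  then have "\<bar>(\<Sum>j<s. of_int (displacement c (i # ns) j) * \<tau> j) - (y n - y m) - (g - h)\<bar>
    \<le> (real (length (i # ns)) + 1) * \<delta>"
    using g(2) h(2) by (simp add: algebra_simps)
  then show ?case
    using G(2)[OF g(1) h(1)] by blast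
qed

text \<open>If the functional \<open>u\<close> kills every small vector that is nearly in \<open>G\<close> when paired with \<open>\<tau>\<close>, it kills the
  displacements of all short closed paths of colours, hence of all closed paths, in particular of the path
  that the walk follows between two times of the same colour.\<close>

lemma annihilator_constant_on_colors:
  fixes c :: "nat \<Rightarrow> nat \<Rightarrow> int" and \<tau> :: "nat \<Rightarrow> real" and G :: "real set" and s :: nat
  defines "y \<equiv> \<lambda>n. \<Sum>j<s. of_int (c n j) * \<tau> j"
  assumes G: "0 \<in> G" "\<And>g h. \<lbrakk>g \<in> G; h \<in> G\<rbrakk> \<Longrightarrow> g - h \<in> G"
    and close: "\<And>m n. a m = a n \<Longrightarrow> \<exists>g\<in>G. \<bar>y m - y n - g\<bar> \<le> \<delta>"
    and a: "finite (range a)" "card (range a) \<le> N"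
    and step: "\<And>n j. j < s \<Longrightarrow> \<bar>c (Suc n) j - c n j\<bar> \<le> int P"
    and u: "\<And>d. \<lbrakk>\<And>j. j < s \<Longrightarrow> \<bar>d j\<bar> \<le> int (N * P);
        \<exists>g\<in>G. \<bar>(\<Sum>j<s. of_int (d j) * \<tau> j) - g\<bar> \<le> 2 * real N * \<delta>\<rbrakk>
      \<Longrightarrow> (\<Sum>j<s. u j * d j) = 0"
    and "a m = a n"
  shows "(\<Sum>j<s. u j * c m j) = (\<Sum>j<s. u j * c n j)"
proof -
  have \<delta>: "\<delta> \<ge> 0"
    using close[of m m] by force
  have closed: "(\<Sum>j<s. u j * displacement c ns j) = 0" if "color_walk a p ns p" for p ns
    using that a(1)
  proof (induction rule: closed_walk_induct)
    case (short p ns)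
    show ?case
    proof (cases ns)
      case Nil
      then show ?thesis by (simp add: displacement_def)
    next
      case (Cons i ms)
      then have p: "a i = p"
        using short(1) by simp
      show ?thesis
      proof (rule u)
        fix j assume "j < s"
        then have "\<bar>displacement c ns j\<bar> \<le> int (length ns * P)"
          using step by (intro abs_displacement_le) auto
        also have "\<dots> \<le> int (N * P)"
          using short(2) a(2) by (intro iffD2[OF of_nat_le_iff] mult_le_mono1) simp
        finally show "\<bar>displacement c ns j\<bar> \<le> int (N * P)" .
      next
        have "length ns \<le> N" "1 \<le> length ns"
          using short(2) a(2) Cons by auto
        then have "(real (length ns) + 1) * \<delta> \<le> 2 * real N * \<delta>"
          using \<delta> by (intro mult_right_mono) auto
        then show "\<exists>g\<in>G. \<bar>(\<Sum>j<s. of_int (displacement c ns j) * \<tau> j) - g\<bar> \<le> 2 * real N * \<delta>"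
          using color_walk_drift[OF G close[unfolded y_def] short(1) p p] by force
      qed
    qed
  next
    case (append us vs ws)
    then show ?case
      by (simp add: displacement_append algebra_simps sum.distrib)
  qed
  have *: "(\<Sum>j<s. u j * c (i + k) j) = (\<Sum>j<s. u j * c i j)" if "a i = a (i + k)" for i k
    using closed[of "a i" "[i..<i + k]"] color_walk_upt[of a i k] that
    by (simp add: displacement_upt algebra_simps sum_subtractf)
  show ?thesis
  proof (cases m n rule: le_cases)
    case le
    then show ?thesis
      using *[of m "n - m"] assms(9) by simp
  next
    case ge
    then show ?thesis
      using *[of n "m - n"] assms(9) by simp
  qed
qed

text \<open>When no functional is finitely valued on the walk, the displacements of short closed paths contain a basis
  of \<open>\<rat>\<^sup>s\<close>, and Cramer's rule applies to it. With \<open>G = \<int>\<close> the result is a rational approximation of \<open>\<tau>\<close> with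
  common denominator \<open>q\<close>; with \<open>G = {0}\<close> it says that \<open>\<tau>\<close> itself is small.\<close>

lemma simultaneous_approximation:
  fixes c :: "nat \<Rightarrow> nat \<Rightarrow> int" and \<tau> :: "nat \<Rightarrow> real" and G :: "real set" and s :: nat
  defines "y \<equiv> \<lambda>n. \<Sum>j<s. of_int (c n j) * \<tau> j"
  assumes G: "0 \<in> G" "\<And>g h. \<lbrakk>g \<in> G; h \<in> G\<rbrakk> \<Longrightarrow> g - h \<in> G"
    and close: "\<And>m n. a m = a n \<Longrightarrow> \<exists>g\<in>G. \<bar>y m - y n - g\<bar> \<le> \<delta>"
    and a: "finite (range a)" "card (range a) \<le> N"
    and step: "\<And>n j. j < s \<Longrightarrow> \<bar>c (Suc n) j - c n j\<bar> \<le> int P"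
    and "P > 0" "s > 0"
    and free: "\<And>u j. \<lbrakk>j < s; u j \<noteq> 0\<rbrakk> \<Longrightarrow> infinite (range (\<lambda>n. \<Sum>j<s. u j * c n j))"
  shows "\<exists>(q :: int) g. q \<noteq> 0 \<and> \<bar>real_of_int q\<bar> \<le> fact s * real (N * P) ^ s \<and>
    (\<forall>j<s. g j \<in> G \<and> \<bar>of_int q * \<tau> j - g j\<bar> \<le> 2 * fact s * real (N * P) ^ s * \<delta>)"
proof -
  define \<A> where "\<A> = {d. (\<forall>j<s. \<bar>d j\<bar> \<le> int (N * P)) \<and>
    (\<exists>g\<in>G. \<bar>(\<Sum>j<s. of_int (d j) * \<tau> j) - g\<bar> \<le> 2 * real N * \<delta>)}"
  have \<delta>: "\<delta> \<ge> 0"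
    using close[of 0 0] by force
  have bnd: "\<bar>d j\<bar> \<le> int (N * P)" if "d \<in> \<A>" "j < s" for d j
    using that by (auto simp: \<A>_def)
  have ann: "\<exists>d\<in>\<A>. (\<Sum>j<s. u j * d j) \<noteq> 0" if "j < s" "u j \<noteq> 0" for u j
  proof (rule ccontr)
    assume no: "\<not> ?thesis"
    have eq: "(\<Sum>j<s. u j * c m j) = (\<Sum>j<s. u j * c n j)" if "a m = a n" for m n
    proof (rule annihilator_constant_on_colors[where a = a and c = c and \<tau> = \<tau> and G = G and \<delta> = \<delta>
          and N = N and P = P])
      fix d assume "\<And>j. j < s \<Longrightarrow> \<bar>d j\<bar> \<le> int (N * P)"
        "\<exists>g\<in>G. \<bar>(\<Sum>j<s. of_int (d j) * \<tau> j) - g\<bar> \<le> 2 * real N * \<delta>"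
      then show "(\<Sum>j<s. u j * d j) = 0"
        using no by (auto simp: \<A>_def)
    next
      fix g h assume "g \<in> G" "h \<in> G"
      then show "g - h \<in> G" by (rule G(2))
    next
      fix m n assume "a m = a n"
      then show "\<exists>g\<in>G. \<bar>(\<Sum>j<s. of_int (c m j) * \<tau> j) - (\<Sum>j<s. of_int (c n j) * \<tau> j) - g\<bar> \<le> \<delta>"
        using close by (simp add: y_def)
    next
      fix n j assume "j < s"
      then show "\<bar>c (Suc n) j - c n j\<bar> \<le> int P" by (rule step)
    qed (use G(1) a that in auto)
    \<comment> \<open>the functional factors through the finitely many colours\<close>
    have "(\<Sum>j<s. u j * c n j) \<in> (\<lambda>p. \<Sum>j<s. u j * c (inv_into UNIV a p) j) ` range a" for n
      using eq[of n "inv_into UNIV a (a n)"] by (intro image_eqI[of _ _ "a n"]) (simp_all add: f_inv_into_f)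
    then have "finite (range (\<lambda>n. \<Sum>j<s. u j * c n j))"
      using a(1) by (blast intro: finite_subset[OF image_subsetI] finite_imageI)
    then show False
      using free that by blast
  qed
  obtain q D B where q: "q \<noteq> 0" "\<bar>q\<bar> \<le> int (fact s * (N * P) ^ s)"
    and D: "\<And>i. i < s \<Longrightarrow> D i \<in> \<A>"
    and B: "\<And>i j. \<lbrakk>i < s; j < s\<rbrakk> \<Longrightarrow> \<bar>B j i\<bar> \<le> int (fact (s - 1) * (N * P) ^ (s - 1))"
    and eq: "\<And>(\<theta> :: nat \<Rightarrow> real) j. j < s \<Longrightarrow>
      of_int q * \<theta> j = (\<Sum>i<s. of_int (B j i) * (\<Sum>k<s. of_int (D i k) * \<theta> k))"
    by (rule bounded_cramer[of \<A> s "N * P"]) ((rule bnd ann; assumption)+, rule that)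
  have "\<forall>i\<in>{..<s}. \<exists>g. g \<in> G \<and> \<bar>(\<Sum>j<s. of_int (D i j) * \<tau> j) - g\<bar> \<le> 2 * real N * \<delta>"
    using D by (auto simp: \<A>_def)
  then obtain g where "\<forall>i\<in>{..<s}. g i \<in> G \<and> \<bar>(\<Sum>j<s. of_int (D i j) * \<tau> j) - g i\<bar> \<le> 2 * real N * \<delta>"
    by (rule bchoice[THEN exE])
  then have g: "\<And>i. i < s \<Longrightarrow> g i \<in> G"
      "\<And>i. i < s \<Longrightarrow> \<bar>(\<Sum>j<s. of_int (D i j) * \<tau> j) - g i\<bar> \<le> 2 * real N * \<delta>"
    by auto
  have add: "g + h \<in> G" if "g \<in> G" "h \<in> G" for g h
    using G(2)[OF that(1) G(2)[OF G(1) that(2)]] by simp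
  have nat_mult: "of_nat k * g \<in> G" if "g \<in> G" for k g
    using that by (induction k) (auto simp: G(1) add distrib_right)
  have int_mult: "of_int k * g \<in> G" if "g \<in> G" for k :: int and g
  proof (cases k)
    case (nonneg n)
    then show ?thesis
      using nat_mult[OF that, of n] by simp
  next
    case (neg n)
    then have "of_int k = - real (Suc n)"
      by (simp only: of_int_minus of_int_of_nat_eq)
    then have "of_int k * g = 0 - of_nat (Suc n) * g"
      by (simp only: mult_minus_left diff_0)
    then show ?thesis
      using G(2)[OF G(1) nat_mult[OF that, of "Suc n"]] by simp
  qed
  have sum_G: "(\<Sum>i\<in>I. f i) \<in> G" if "\<And>i. i \<in> I \<Longrightarrow> f i \<in> G" for I :: "nat set" and f
    using that by (induction I rule: infinite_finite_induct) (auto simp: G(1) add)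
  define h where "h j = (\<Sum>i<s. of_int (B j i) * g i)" for j
  show ?thesis
  proof (intro exI[of _ q] exI[of _ h] conjI allI impI)
    show "q \<noteq> 0" by (rule q)
    have "real_of_int \<bar>q\<bar> \<le> real_of_int (int (fact s * (N * P) ^ s))"
      using q(2) by (rule iffD2[OF of_int_le_iff])
    then show "\<bar>real_of_int q\<bar> \<le> fact s * real (N * P) ^ s"
      by simp
    show "h j \<in> G" if "j < s" for j
      unfolding h_def using g(1) by (intro sum_G int_mult) simp
    show "\<bar>of_int q * \<tau> j - h j\<bar> \<le> 2 * fact s * real (N * P) ^ s * \<delta>" if "j < s" for j
    proof -
      define E where "E = fact (s - 1) * real (N * P) ^ (s - 1)"
      have E: "E \<ge> 0" by (simp add: E_def)
      have "of_int q * \<tau> j - h j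
          = (\<Sum>i<s. of_int (B j i) * ((\<Sum>k<s. of_int (D i k) * \<tau> k) - g i))"
        unfolding eq[OF that] h_def by (simp add: right_diff_distrib sum_subtractf)
      also have "\<bar>\<dots>\<bar> \<le> (\<Sum>i<s. E * (2 * real N * \<delta>))"
      proof (rule order_trans[OF sum_abs sum_mono])
        fix i assume "i \<in> {..<s}"
        then have i: "i < s" by simp
        have "real_of_int \<bar>B j i\<bar> \<le> real_of_int (int (fact (s - 1) * (N * P) ^ (s - 1)))"
          using B[OF i that] by (rule iffD2[OF of_int_le_iff])
        then have "\<bar>real_of_int (B j i)\<bar> \<le> E"
          by (simp add: E_def)
        then show "\<bar>of_int (B j i) * ((\<Sum>k<s. of_int (D i k) * \<tau> k) - g i)\<bar> \<le> E * (2 * real N * \<delta>)"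
          using g(2)[OF i] E unfolding abs_mult by (intro mult_mono) auto
      qed
      also have "\<dots> = 2 * (real s * E) * (real N * \<delta>)"
        by simp
      also have "\<dots> \<le> 2 * (real s * E) * (real (N * P) * \<delta>)"
      proof -
        have "real N \<le> real (N * P)"
          using \<open>P > 0\<close> mult_left_mono[of 1 "real P" "real N"] by simp
        then show ?thesis
          using \<delta> E by (intro mult_left_mono mult_right_mono) auto
      qed
      also have "\<dots> = 2 * fact s * real (N * P) ^ s * \<delta>"
      proof -
        obtain s' where "s = Suc s'"
          using \<open>s > 0\<close> by (cases s) auto
        then show ?thesis
          by (simp add: E_def algebra_simps)
      qed
      finally show ?thesis .
    qed
  qed
qed

section \<open>Slow walks on the circle\<close>

text \<open>A walk with steps at most \<open>h\<close> that climbs by 1 comes within \<open>h\<close> of each of \<open>M + 1\<close> equally spaced points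
  of an interval of length 1. Since \<open>h\<close> is small compared with their spacing, these visits are pairwise
  more than \<open>h\<close> apart on the circle, which is too much for \<open>M\<close> colours.\<close>

lemma slow_walk_rises_less_than_one:
  fixes w :: "nat \<Rightarrow> real"
  assumes step: "\<And>n. \<bar>w (Suc n) - w n\<bar> \<le> h"
    and a: "finite (range a)" "card (range a) \<le> M"
    and close: "\<And>m n. a m = a n \<Longrightarrow> \<exists>k::int. \<bar>w m - w n - of_int k\<bar> \<le> h"
    and small: "2 * (real M + 1) * h < 1"
  shows "w n - w 0 < 1"
proof (rule ccontr)
  assume "\<not> ?thesis"
  then have n: "w n \<ge> w 0 + 1" by simp
  define t where "t i = w 0 + real i / (real M + 1)" for i
  have h: "h \<ge> 0"
    using step[of 0] by linarith
  have "\<forall>i\<in>{..M}. \<exists>k. t i \<le> w k \<and> w k \<le> t i + h"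
  proof
    fix i assume "i \<in> {..M}"
    then have "real i / (real M + 1) \<le> 1"
      by (simp add: field_simps)
    then have "t i \<le> w n"
      using n unfolding t_def by linarith
    then obtain k where "t i \<le> w k" "\<forall>k'<k. \<not> t i \<le> w k'"
      using exists_least_iff[of "\<lambda>k. t i \<le> w k"] by blast
    then have k: "t i \<le> w k" "\<And>k'. k' < k \<Longrightarrow> w k' < t i"
      by auto
    have "w k \<le> t i + h"
    proof (cases k)
      case 0
      then show ?thesis
        using h by (simp add: t_def)
    next
      case (Suc k')
      then show ?thesis
        using k(2)[of k'] step[of k'] by simp
    qed
    then show "\<exists>k. t i \<le> w k \<and> w k \<le> t i + h"
      using k(1) by blast
  qed
  then obtain f where "\<forall>i\<in>{..M}. t i \<le> w (f i) \<and> w (f i) \<le> t i + h"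
    by (rule bchoice[THEN exE])
  then have f: "\<And>i. i \<le> M \<Longrightarrow> t i \<le> w (f i)" "\<And>i. i \<le> M \<Longrightarrow> w (f i) \<le> t i + h"
    by auto
  have "\<not> inj_on (\<lambda>i. a (f i)) {..M}"
  proof
    assume "inj_on (\<lambda>i. a (f i)) {..M}"
    then have "card {..M} \<le> card (range a)"
      by (rule card_inj_on_le[OF _ _ a(1)]) auto
    then show False
      using a(2) by simp
  qed
  then obtain i j where ij: "i < j" "j \<le> M" "a (f j) = a (f i)"
    using linorder_inj_onI'[of "{..M}" "\<lambda>i. a (f i)"] by force
  obtain k :: int where k: "\<bar>w (f j) - w (f i) - of_int k\<bar> \<le> h"
    using close[OF ij(3)] by blast
  have tt: "t j - t i = real (j - i) / (real M + 1)"
    using ij(1) by (simp add: t_def diff_divide_distrib of_nat_diff)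
  have "real (j - i) / (real M + 1) \<le> real M / (real M + 1)"
    using ij by (intro divide_right_mono) auto
  then have up: "t j - t i \<le> 1 - 1 / (real M + 1)"
    unfolding tt by (simp add: field_simps)
  have "1 / (real M + 1) \<le> real (j - i) / (real M + 1)"
    using ij by (intro divide_right_mono) auto
  then have lo: "1 / (real M + 1) \<le> t j - t i"
    unfolding tt .
  have hh: "2 * h < 1 / (real M + 1)"
    using small by (simp add: field_simps)
  have "w (f j) - w (f i) > h" "w (f j) - w (f i) < 1 - h"
    using f[of i] f[of j] ij up lo hh by linarith+
  then have "real_of_int k > 0" "real_of_int k < 1"
    using k h by linarith+
  then show False by simp
qed

lemma slow_walk_confined:
  fixes w :: "nat \<Rightarrow> real"
  assumes step: "\<And>n. \<bar>w (Suc n) - w n\<bar> \<le> h"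
    and a: "finite (range a)" "card (range a) \<le> M"
    and close: "\<And>m n. a m = a n \<Longrightarrow> \<exists>k::int. \<bar>w m - w n - of_int k\<bar> \<le> h"
    and small: "2 * (real M + 1) * h < 1"
  shows "\<bar>w n - w 0\<bar> < 1"
proof -
  have "w n - w 0 < 1"
    by (rule slow_walk_rises_less_than_one[where w = w and a = a, OF step a close small])
  moreover have "- w n - - w 0 < 1"
  proof (rule slow_walk_rises_less_than_one[OF _ a _ small])
    show "\<bar>- w (Suc n) - - w n\<bar> \<le> h" for n
      using step[of n] by simp
    show "\<exists>k::int. \<bar>- w m - - w n - of_int k\<bar> \<le> h" if mn: "a m = a n" for m n
    proof -
      obtain k :: int where "\<bar>w m - w n - of_int k\<bar> \<le> h"
        using close[OF mn] by blast
      then show ?thesis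
        by (intro exI[of _ "- k"]) simp
    qed
  qed
  ultimately show ?thesis by simp
qed

section \<open>Coding an orbit by a lattice walk\<close>

text \<open>The finite set \<open>Z\<close> of offsets absorbs everything that is bounded or rational: the starting point, the
  rational parts of the steps, and the finitely many values lost when a coordinate is eliminated.\<close>

definition lattice_coding ::
  "(nat \<Rightarrow> circle) \<Rightarrow> nat \<Rightarrow> (nat \<Rightarrow> real) \<Rightarrow> (nat \<Rightarrow> nat \<Rightarrow> int) \<Rightarrow> nat \<Rightarrow> circle set \<Rightarrow> bool" where
  "lattice_coding x s \<tau> c P Z \<longleftrightarrow> finite Z \<and> P > 0 \<and>
    (\<forall>n. x n - circle_of (\<Sum>j<s. of_int (c n j) * \<tau> j) \<in> Z) \<and>
    (\<forall>n. \<forall>j<s. \<bar>c (Suc n) j - c n j\<bar> \<le> int P)"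

text \<open>Solving for the coordinate \<open>j0\<close> in terms of the value of the functional and the other coordinates changes
  \<open>\<tau>\<close> and contributes only finitely many new offsets.\<close>

lemma lattice_coding_reduce:
  assumes coding: "lattice_coding x s \<tau> c P Z"
    and u: "j0 < s" "u j0 \<noteq> 0" "finite (range (\<lambda>n. \<Sum>j<s. u j * c n j))"
  shows "\<exists>\<tau>' c' Z'. lattice_coding x (s - 1) \<tau>' c' P Z'"
proof -
  \<comment> \<open>\<open>\<sigma>\<close> enumerates the coordinates other than \<open>j0\<close>\<close>
  define \<sigma> where "\<sigma> i = (if i < j0 then i else Suc i)" for i
  define v where "v n = (\<Sum>j<s. u j * c n j)" for n
  define \<kappa> where "\<kappa> = \<tau> j0 / of_int (u j0)"
  define \<tau>' where "\<tau>' i = \<tau> (\<sigma> i) - of_int (u (\<sigma> i)) * \<kappa>" for i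
  define Z' where "Z' = (\<lambda>(z, v). z + circle_of (of_int v * \<kappa>)) ` (Z \<times> range v)"
  have bij: "bij_betw \<sigma> {..<s - 1} ({..<s} - {j0})"
    by (rule bij_betw_byWitness[where f' = "\<lambda>j. if j < j0 then j else j - 1"])
      (use u(1) in \<open>auto simp: \<sigma>_def\<close>)
  have "(\<Sum>j<s. of_int (c n j) * \<tau> j)
      = (\<Sum>i<s - 1. of_int (c n (\<sigma> i)) * \<tau>' i) + of_int (v n) * \<kappa>" for n
  proof -
    have split: "(\<Sum>j<s. f j) = f j0 + (\<Sum>i<s - 1. f (\<sigma> i))" for f :: "nat \<Rightarrow> real"
      using u(1) by (subst sum.reindex_bij_betw[OF bij]) (simp add: sum.remove)
    have "of_int (v n) = of_int (u j0) * of_int (c n j0)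
        + (\<Sum>i<s - 1. of_int (u (\<sigma> i)) * (of_int (c n (\<sigma> i)) :: real))"
      unfolding v_def of_int_sum of_int_mult by (rule split)
    then have "of_int (v n) * \<kappa> = of_int (c n j0) * (of_int (u j0) * \<kappa>)
        + (\<Sum>i<s - 1. of_int (u (\<sigma> i)) * of_int (c n (\<sigma> i)) * \<kappa>)"
      by (simp add: distrib_right sum_distrib_right)
    moreover have "of_int (u j0) * \<kappa> = \<tau> j0"
      using u(2) by (simp add: \<kappa>_def)
    ultimately have "of_int (v n) * \<kappa> = of_int (c n j0) * \<tau> j0
        + (\<Sum>i<s - 1. of_int (u (\<sigma> i)) * of_int (c n (\<sigma> i)) * \<kappa>)"
      by simp
    then show ?thesis
      unfolding split by (simp add: \<tau>'_def right_diff_distrib sum_subtractf mult.left_commute mult.commute)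
  qed
  then have *: "x n - circle_of (\<Sum>j<s. of_int (c n j) * \<tau> j) + circle_of (of_int (v n) * \<kappa>)
      = x n - circle_of (\<Sum>i<s - 1. of_int (c n (\<sigma> i)) * \<tau>' i)" for n
    by (simp add: circle_of_add algebra_simps)
  have "lattice_coding x (s - 1) \<tau>' (\<lambda>n i. c n (\<sigma> i)) P Z'"
    unfolding lattice_coding_def
  proof (intro conjI allI impI)
    show "finite Z'"
      using coding u(3) unfolding Z'_def lattice_coding_def v_def by blast
    show "P > 0"
      using coding by (simp add: lattice_coding_def)
  next
    fix n
    have "x n - circle_of (\<Sum>j<s. of_int (c n j) * \<tau> j) \<in> Z"
      using coding by (simp add: lattice_coding_def)
    then show "x n - circle_of (\<Sum>i<s - 1. of_int (c n (\<sigma> i)) * \<tau>' i) \<in> Z'"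
      unfolding *[symmetric] Z'_def by force
  next
    fix n i assume "i < s - 1"
    then have "\<sigma> i < s"
      by (auto simp: \<sigma>_def)
    then show "\<bar>c (Suc n) (\<sigma> i) - c n (\<sigma> i)\<bar> \<le> int P"
      using coding by (simp add: lattice_coding_def)
  qed
  then show ?thesis by blast
qed

lemma finite_circle_of_fractions:
  assumes "q \<noteq> 0"
  shows "finite (circle_of ` range (\<lambda>k::int. of_int k / of_int q))"
proof -
  have "circle_of (of_int k / of_int q) \<in> (\<lambda>i. circle_of (of_int i / of_int q)) ` {- \<bar>q\<bar>..\<bar>q\<bar>}" for k
  proof (rule image_eqI)
    have "real_of_int k = of_int q * of_int (k div q) + of_int (k mod q)"
      by (metis mult_div_mod_eq of_int_add of_int_mult)
    then have "of_int k / of_int q - of_int (k mod q) / (of_int q :: real) = of_int (k div q)"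
      using assms by (simp add: field_simps)
    then show "circle_of (of_int k / of_int q) = circle_of (of_int (k mod q) / of_int q)"
      by (simp add: circle_of_eq_iff)
    show "k mod q \<in> {- \<bar>q\<bar>..\<bar>q\<bar>}"
      using assms abs_mod_less[of q k] by auto
  qed
  then show ?thesis
    by (intro finite_subset[OF image_subsetI finite_imageI[OF finite_atLeastAtMost_int]]) auto
qed

lemma lattice_coding_rational_finite:
  assumes "lattice_coding x s \<tau> c P Z" "q \<noteq> 0" "\<And>j. j < s \<Longrightarrow> of_int q * \<tau> j = of_int (p j)"
  shows "finite (range x)"
proof -
  let ?F = "circle_of ` range (\<lambda>k::int. of_int k / of_int q)"
  have "x n \<in> (\<lambda>(z, f). z + f) ` (Z \<times> ?F)" for n
  proof -
    have "of_int q * (\<Sum>j<s. of_int (c n j) * \<tau> j) = (\<Sum>j<s. of_int (c n j) * (of_int q * \<tau> j))"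
      by (simp add: sum_distrib_left algebra_simps)
    also have "\<dots> = of_int (\<Sum>j<s. c n j * p j)"
      by (simp add: assms(3))
    finally have "(\<Sum>j<s. of_int (c n j) * \<tau> j) = of_int (\<Sum>j<s. c n j * p j) / of_int q"
      using assms(2) by (simp add: field_simps)
    then have "circle_of (\<Sum>j<s. of_int (c n j) * \<tau> j) \<in> ?F"
      by blast
    moreover have "x n - circle_of (\<Sum>j<s. of_int (c n j) * \<tau> j) \<in> Z"
      using assms(1) by (simp add: lattice_coding_def)
    ultimately show ?thesis
      by (intro image_eqI[of _ _ "(x n - circle_of (\<Sum>j<s. of_int (c n j) * \<tau> j),
        circle_of (\<Sum>j<s. of_int (c n j) * \<tau> j))"]) auto
  qed
  moreover have "finite ((\<lambda>(z, f). z + f) ` (Z \<times> ?F))"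
  proof (rule finite_imageI, rule finite_cartesian_product)
    show "finite Z"
      using assms(1) by (simp add: lattice_coding_def)
    show "finite ?F"
      by (rule finite_circle_of_fractions) (rule assms(2))
  qed
  ultimately show ?thesis
    by (meson finite_subset image_subsetI)
qed

section \<open>The covering number of a coded orbit\<close>

lemma finite_range_card_le:
  assumes "finite B" "\<And>n. f n \<in> B"
  shows "finite (range f)" "card (range f) \<le> card B"
  using assms by (auto intro: finite_subset card_mono)

text \<open>The dichotomy at the heart of the dimension bound. If for some \<open>q \<noteq> 0\<close> and \<open>p\<close> the real walk
  \<open>w\<^sub>n = c\<^sub>n \<cdot> (q \<tau> - p)\<close> is bounded, then \<open>\<theta> = q \<tau> - p\<close> is a fixed nonzero vector, and the approximation
  lemma on the line bounds it by a multiple of \<open>N\<^sup>s \<delta>\<close> at every scale. If no such walk is bounded, then the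
  approximation found at scale \<open>\<delta>\<close> gives an unbounded slow walk, which needs many covering sets.\<close>

lemma covering_number_power_ge:
  fixes x :: "nat \<Rightarrow> circle"
  assumes coding: "lattice_coding x s \<tau> c P Z"
    and "infinite (range x)" "range x \<subseteq> K"
    and free: "\<And>u j. \<lbrakk>j < s; u j \<noteq> 0\<rbrakk> \<Longrightarrow> infinite (range (\<lambda>n. \<Sum>j<s. u j * c n j))"
  shows "\<exists>C>0. \<forall>\<delta>. 0 < \<delta> \<longrightarrow> \<delta> < 1 \<longrightarrow> C \<le> real (covering_number \<delta> K) ^ (s + 1) * \<delta>"
proof -
  define y where "y n = (\<Sum>j<s. of_int (c n j) * \<tau> j)" for n
  define z where "z n = x n - circle_of (y n)" for n
  define N where "N \<delta> = covering_number \<delta> K" for \<delta>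
  have Z: "finite Z" "z n \<in> Z" and P: "P > 0"
    and step: "\<And>n j. j < s \<Longrightarrow> \<bar>c (Suc n) j - c n j\<bar> \<le> int P" for n
    using coding by (auto simp: lattice_coding_def z_def y_def)
  have s: "s > 0"
  proof (rule ccontr)
    assume "\<not> s > 0"
    then have "range x \<subseteq> Z"
      using Z(2) by (auto simp: z_def y_def zero_circle_def[symmetric])
    then show False
      using assms(2) Z(1) finite_subset by blast
  qed
  have Z0: "card Z > 0"
    using Z card_gt_0_iff by blast
  have cover: "\<exists>(\<U> :: circle set set) U. finite \<U> \<and> card \<U> = N \<delta> \<and> (\<forall>n. U n \<in> \<U>) \<and>
      (\<forall>m n. (U m, z m) = (U n, z n) \<longrightarrow> (\<exists>k::int. \<bar>y m - y n - of_int k\<bar> \<le> \<delta>))"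
    if "\<delta> > 0" for \<delta> :: real
  proof -
    obtain \<U> where \<U>: "finite \<U>" "card \<U> = N \<delta>" "K \<subseteq> \<Union>\<U>"
      "\<And>U p q. \<lbrakk>U \<in> \<U>; p \<in> U; q \<in> U\<rbrakk> \<Longrightarrow> dist p q \<le> \<delta>"
      using covering_number_witness[OF \<open>\<delta> > 0\<close>, of K] unfolding N_def by metis
    have "\<forall>n. \<exists>U. U \<in> \<U> \<and> x n \<in> U"
      using \<U>(3) assms(3) by blast
    then obtain U where U: "\<forall>n. U n \<in> \<U> \<and> x n \<in> U n"
      by (rule choice[THEN exE])
    have close: "\<exists>k::int. \<bar>y m - y n - of_int k\<bar> \<le> \<delta>" if "(U m, z m) = (U n, z n)" for m n
    proof -
      have "dist (circle_of (y m)) (circle_of (y n)) = dist (x m - z m) (x n - z n)"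
        by (simp add: z_def)
      also have "\<dots> \<le> dist (x m) (x n)"
        using dist_circle_diff_le[of "x m" "z m" "x n" "z n"] that by simp
      also have "\<dots> \<le> \<delta>"
        using \<U>(4)[of "U m"] U that by (metis prod.inject)
      finally show ?thesis
        by (metis dist_circle_of)
    qed
    show ?thesis
      by (intro exI[of _ \<U>] exI[of _ U] conjI allI impI) (use \<U>(1,2) U close in auto)
  qed
  have N: "N \<delta> > 0" if \<delta>: "\<delta> > 0" for \<delta>
  proof -
    obtain \<U> and U :: "nat \<Rightarrow> circle set" where "finite \<U>" "card \<U> = N \<delta>" "\<forall>n. U n \<in> \<U>"
      using cover[OF \<delta>] by blast
    then show ?thesis
      by (metis card_gt_0_iff empty_iff)
  qed
  define w where "w q p n = (\<Sum>j<s. of_int (c n j) * (of_int q * \<tau> j - of_int (p j)))"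
    for q :: int and p :: "nat \<Rightarrow> int" and n
  have w: "w q p n = of_int q * y n - of_int (\<Sum>j<s. c n j * p j)" for q p n
    by (simp add: w_def y_def sum_distrib_left right_diff_distrib sum_subtractf algebra_simps)
  have w_close: "\<exists>k::int. \<bar>w q p m - w q p n - of_int k\<bar> \<le> \<bar>of_int q\<bar> * \<delta>"
    if "\<bar>y m - y n - of_int k\<bar> \<le> \<delta>" for q p m n k and \<delta> :: real
  proof -
    have "w q p m - w q p n - of_int (q * k - (\<Sum>j<s. c m j * p j) + (\<Sum>j<s. c n j * p j))
        = of_int q * (y m - y n - of_int k)"
      by (simp add: w algebra_simps)
    then have "\<bar>w q p m - w q p n - of_int (q * k - (\<Sum>j<s. c m j * p j) + (\<Sum>j<s. c n j * p j))\<bar>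
        \<le> \<bar>of_int q\<bar> * \<delta>"
      using that by (simp add: abs_mult mult_left_mono)
    then show ?thesis by blast
  qed
  show ?thesis
  proof (cases "\<exists>q p W. q \<noteq> 0 \<and> (\<forall>n. \<bar>w q p n\<bar> \<le> W)")
    case True
    then obtain q p W where q: "q \<noteq> 0" and W: "\<And>n. \<bar>w q p n\<bar> \<le> W"
      by blast
    define \<theta> where "\<theta> j = of_int q * \<tau> j - of_int (p j)" for j
    \<comment> \<open>refining the colours by \<open>\<lfloor>2 w\<^sub>n\<rfloor>\<close> costs a constant factor \<open>card E\<close>, but makes equally coloured values of \<open>w\<close> less than
      \<open>1/2\<close> apart, so that closeness modulo 1 becomes closeness on the line\<close>
    define E where "E = {\<lfloor>- 2 * W\<rfloor>..\<lfloor>2 * W\<rfloor>}"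
    obtain j where j: "j < s" "\<theta> j \<noteq> 0"
      using lattice_coding_rational_finite[OF coding q, of p] assms(2) by (auto simp: \<theta>_def)
    define C where "C = 2 * fact s * real (card Z * card E * P) ^ s * \<bar>real_of_int q\<bar>"
    have bound: "\<bar>\<theta> j\<bar> \<le> C * (real (N \<delta>) ^ (s + 1) * \<delta>)" if \<delta>: "\<delta> > 0" for \<delta>
    proof -
      obtain \<U> and U :: "nat \<Rightarrow> circle set" where \<U>: "finite \<U>" "card \<U> = N \<delta>" "\<And>n. U n \<in> \<U>"
        "\<And>m n. (U m, z m) = (U n, z n) \<Longrightarrow> \<exists>k::int. \<bar>y m - y n - of_int k\<bar> \<le> \<delta>"
        using cover[OF \<delta>] by blast
      define a where "a n = (U n, z n, \<lfloor>2 * w q p n\<rfloor>)" for n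
      have "a n \<in> \<U> \<times> Z \<times> E" for n
        using \<U>(3) Z(2) W[of n] by (auto simp: a_def E_def abs_le_iff intro!: floor_mono)
      then have fin: "finite (range a)" "card (range a) \<le> N \<delta> * card Z * card E"
        using finite_range_card_le[of "\<U> \<times> Z \<times> E" a] \<U>(1,2) Z(1) by (auto simp: E_def card_cartesian_product)
      have close: "\<bar>w q p m - w q p n\<bar> \<le> \<bar>of_int q\<bar> * \<delta>" if same: "a m = a n" for m n
      proof -
        have "(U m, z m) = (U n, z n)"
          using same by (simp add: a_def)
        then obtain k' :: int where "\<bar>y m - y n - of_int k'\<bar> \<le> \<delta>"
          using \<U>(4) by blast
        then obtain k :: int where k: "\<bar>w q p m - w q p n - of_int k\<bar> \<le> \<bar>of_int q\<bar> * \<delta>"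
          using w_close by blast
        have fl: "\<lfloor>2 * w q p m\<rfloor> = \<lfloor>2 * w q p n\<rfloor>"
          using same by (simp add: a_def)
        have "\<bar>w q p m - w q p n\<bar> < 1 / 2"
          using floor_correct[of "2 * w q p m"] floor_correct[of "2 * w q p n"] unfolding fl by linarith
        moreover have "k = 0 \<or> 1 \<le> \<bar>real_of_int k\<bar>"
          by linarith
        ultimately show ?thesis
          using k by (elim disjE) (simp, linarith)
      qed
      have "\<exists>(q' :: int) g. q' \<noteq> 0 \<and> \<bar>real_of_int q'\<bar> \<le> fact s * real (N \<delta> * card Z * card E * P) ^ s \<and>
        (\<forall>j<s. g j \<in> {0} \<and> \<bar>of_int q' * \<theta> j - g j\<bar>
          \<le> 2 * fact s * real (N \<delta> * card Z * card E * P) ^ s * (\<bar>of_int q\<bar> * \<delta>))"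
      proof (rule simultaneous_approximation[where c = c and a = a])
        show "\<exists>g\<in>{0}. \<bar>(\<Sum>j<s. of_int (c m j) * \<theta> j) - (\<Sum>j<s. of_int (c n j) * \<theta> j) - g\<bar>
          \<le> \<bar>of_int q\<bar> * \<delta>" if "a m = a n" for m n
          using close[OF that] by (simp add: w_def \<theta>_def)
      next
        fix u :: "nat \<Rightarrow> int" and j assume "j < s" "u j \<noteq> 0"
        then show "infinite (range (\<lambda>n. \<Sum>j<s. u j * c n j))" by (rule free)
      next
        fix n j assume "j < s"
        then show "\<bar>c (Suc n) j - c n j\<bar> \<le> int P" by (rule step)
      qed (use fin P s in simp_all)
      then obtain q' :: int and g where q': "q' \<noteq> 0" "\<And>j. j < s \<Longrightarrow> g j \<in> {0}"
        "\<And>j. j < s \<Longrightarrow> \<bar>of_int q' * \<theta> j - g j\<bar>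
          \<le> 2 * fact s * real (N \<delta> * card Z * card E * P) ^ s * (\<bar>of_int q\<bar> * \<delta>)"
        by blast
      have "1 \<le> \<bar>real_of_int q'\<bar>"
        using q'(1) by linarith
      then have "1 * \<bar>\<theta> j\<bar> \<le> \<bar>real_of_int q'\<bar> * \<bar>\<theta> j\<bar>"
        by (rule mult_right_mono) simp
      also have "\<dots> = \<bar>of_int q' * \<theta> j - g j\<bar>"
        using q'(2)[OF j(1)] by (simp add: abs_mult)
      also have "\<dots> \<le> C * (real (N \<delta>) ^ s * \<delta>)"
        using q'(3)[OF j(1)] by (simp add: C_def power_mult_distrib algebra_simps)
      also have "\<dots> \<le> C * (real (N \<delta>) ^ (s + 1) * \<delta>)"
        using N[OF \<delta>] \<delta> by (intro mult_left_mono mult_right_mono power_increasing) (auto simp: C_def)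
      finally show ?thesis by simp
    qed
    have C: "C > 0"
    proof (rule ccontr)
      assume "\<not> C > 0"
      then have "C * (real (N 1) ^ (s + 1) * 1) \<le> 0"
        by (intro mult_nonpos_nonneg) auto
      then show False
        using bound[of 1] j(2) by simp
    qed
    have "\<bar>\<theta> j\<bar> / C \<le> real (N \<delta>) ^ (s + 1) * \<delta>" if "\<delta> > 0" for \<delta>
      using bound[OF that] C by (simp add: pos_divide_le_eq mult.commute)
    then show ?thesis
      using j(2) C by (intro exI[of _ "\<bar>\<theta> j\<bar> / C"]) (auto simp: N_def)
  next
    case False
    define A where "A = 2 * fact s * real (card Z * P) ^ s"
    define C where "C = 4 * real (card Z) * (real s * real P * A)"
    have A: "A \<ge> 0"
      by (simp add: A_def)
    have bound: "1 \<le> C * (real (N \<delta>) ^ (s + 1) * \<delta>)" if \<delta>: "\<delta> > 0" for \<delta>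
    proof -
      obtain \<U> and U :: "nat \<Rightarrow> circle set" where \<U>: "finite \<U>" "card \<U> = N \<delta>" "\<And>n. U n \<in> \<U>"
        "\<And>m n. (U m, z m) = (U n, z n) \<Longrightarrow> \<exists>k::int. \<bar>y m - y n - of_int k\<bar> \<le> \<delta>"
        using cover[OF \<delta>] by blast
      define a where "a n = (U n, z n)" for n
      have "a n \<in> \<U> \<times> Z" for n
        using \<U>(3) Z(2) by (simp add: a_def)
      then have fin: "finite (range a)" "card (range a) \<le> N \<delta> * card Z"
        using finite_range_card_le[of "\<U> \<times> Z" a] \<U>(1,2) Z(1) by (auto simp: card_cartesian_product)
      define B where "B = A * real (N \<delta>) ^ s"
      have "\<exists>(q :: int) g. q \<noteq> 0 \<and> \<bar>real_of_int q\<bar> \<le> fact s * real (N \<delta> * card Z * P) ^ s \<and>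
        (\<forall>j<s. g j \<in> \<int> \<and> \<bar>of_int q * \<tau> j - g j\<bar> \<le> 2 * fact s * real (N \<delta> * card Z * P) ^ s * \<delta>)"
      proof (rule simultaneous_approximation[where c = c and a = a])
        show "\<exists>g\<in>\<int>. \<bar>(\<Sum>j<s. of_int (c m j) * \<tau> j) - (\<Sum>j<s. of_int (c n j) * \<tau> j) - g\<bar> \<le> \<delta>"
          if "a m = a n" for m n
          using \<U>(4)[of m n] that unfolding a_def y_def by (metis Ints_of_int)
      next
        fix u :: "nat \<Rightarrow> int" and j assume "j < s" "u j \<noteq> 0"
        then show "infinite (range (\<lambda>n. \<Sum>j<s. u j * c n j))" by (rule free)
      next
        fix n j assume "j < s"
        then show "\<bar>c (Suc n) j - c n j\<bar> \<le> int P" by (rule step)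
      qed (use fin P s in simp_all)
      then obtain q :: int and g where q: "q \<noteq> 0"
        "\<bar>real_of_int q\<bar> \<le> fact s * real (N \<delta> * card Z * P) ^ s"
        "\<And>j. j < s \<Longrightarrow> g j \<in> \<int>"
        "\<And>j. j < s \<Longrightarrow> \<bar>of_int q * \<tau> j - g j\<bar>
          \<le> 2 * fact s * real (N \<delta> * card Z * P) ^ s * \<delta>"
        by blast
      have AB: "2 * fact s * real (N \<delta> * card Z * P) ^ s = B"
        by (simp add: A_def B_def power_mult_distrib algebra_simps)
      have qB: "\<bar>real_of_int q\<bar> \<le> B"
      proof -
        have "0 \<le> fact s * real (N \<delta> * card Z * P) ^ s"
          by simp
        then show ?thesis
          using q(2) AB by linarith
      qed
      \<comment> \<open>\<open>g j\<close> is already an integer; the floor only changes its type\<close>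
      define p where "p j = \<lfloor>g j\<rfloor>" for j
      have p: "\<bar>of_int q * \<tau> j - of_int (p j)\<bar> \<le> B * \<delta>" if "j < s" for j
        using q(3,4)[OF that] unfolding AB p_def by (auto elim!: Ints_cases)
      have B: "B \<ge> 0"
        using qB by linarith
      \<comment> \<open>\<open>h\<close> bounds both the steps of \<open>w\<close> and the distances \<open>\<bar>q\<bar> \<delta>\<close> within a colour\<close>
      define h where "h = real s * real P * B * \<delta>"
      have "real s * real P \<ge> 1"
        using s P by (metis One_nat_def Suc_leI nat_0_less_mult_iff of_nat_1 of_nat_le_iff of_nat_mult)
      then have Bh: "B * \<delta> \<le> h"
        unfolding h_def using B \<delta> mult_right_mono[of 1 "real s * real P" "B * \<delta>"] by (simp add: mult.assoc)
      have "\<not> 2 * (real (N \<delta> * card Z) + 1) * h < 1"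
      proof
        assume small: "2 * (real (N \<delta> * card Z) + 1) * h < 1"
        have near: "\<bar>w q p n - w q p 0\<bar> < 1" for n
        proof (rule slow_walk_confined[where a = a, OF _ fin _ small])
          show "\<bar>w q p (Suc n) - w q p n\<bar> \<le> h" for n
          proof -
            have "w q p (Suc n) - w q p n
                = (\<Sum>j<s. of_int (c (Suc n) j - c n j) * (of_int q * \<tau> j - of_int (p j)))"
              unfolding w_def sum_subtractf[symmetric] by (simp add: algebra_simps)
            also have "\<bar>\<dots>\<bar> \<le> (\<Sum>j<s. real P * (B * \<delta>))"
            proof (rule order_trans[OF sum_abs sum_mono])
              fix j assume "j \<in> {..<s}"
              then have j: "j < s" by simp
              have "real_of_int \<bar>c (Suc n) j - c n j\<bar> \<le> real_of_int (int P)"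
                using step[OF j] by (rule iffD2[OF of_int_le_iff])
              then have "\<bar>real_of_int (c (Suc n) j - c n j)\<bar> \<le> real P"
                by simp
              then show "\<bar>of_int (c (Suc n) j - c n j) * (of_int q * \<tau> j - of_int (p j))\<bar> \<le> real P * (B * \<delta>)"
                using p[OF j] unfolding abs_mult by (intro mult_mono) auto
            qed
            also have "\<dots> = h"
              by (simp add: h_def)
            finally show ?thesis .
          qed
          show "\<exists>k::int. \<bar>w q p m - w q p n - of_int k\<bar> \<le> h" if "a m = a n" for m n
          proof -
            obtain k :: int where "\<bar>y m - y n - of_int k\<bar> \<le> \<delta>"
              using \<U>(4)[of m n] \<open>a m = a n\<close> unfolding a_def by blast
            then obtain k' :: int where "\<bar>w q p m - w q p n - of_int k'\<bar> \<le> \<bar>of_int q\<bar> * \<delta>"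
              using w_close by blast
            moreover have "\<bar>of_int q\<bar> * \<delta> \<le> B * \<delta>"
              using qB \<delta> by (intro mult_right_mono) auto
            ultimately show ?thesis
              using Bh by (intro exI[of _ k']) linarith
          qed
        qed
        have "\<bar>w q p n\<bar> \<le> \<bar>w q p 0\<bar> + 1" for n
          using near[of n] by linarith
        then show False
          using False q(1) by blast
      qed
      then have "1 \<le> 2 * (real (N \<delta> * card Z) + 1) * h"
        by simp
      also have "\<dots> \<le> 2 * (2 * real (N \<delta> * card Z)) * h"
      proof -
        have "N \<delta> * card Z \<ge> 1"
          using N[OF \<delta>] Z0 by (simp add: Suc_leI)
        then have "1 \<le> real (N \<delta> * card Z)"
          by (metis of_nat_1 of_nat_le_iff)
        moreover have "h \<ge> 0"
          using Bh B \<delta> by (meson less_imp_le mult_nonneg_nonneg order_trans)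
        ultimately show ?thesis
          by (intro mult_right_mono) (auto simp: mult.commute)
      qed
      also have "\<dots> = C * (real (N \<delta>) ^ (s + 1) * \<delta>)"
        by (simp add: C_def h_def B_def algebra_simps)
      finally show ?thesis .
    qed
    have C: "C > 0"
    proof (rule ccontr)
      assume "\<not> C > 0"
      then have "C * (real (N 1) ^ (s + 1) * 1) \<le> 0"
        by (intro mult_nonpos_nonneg) auto
      then show False
        using bound[of 1] by simp
    qed
    have "1 / C \<le> real (N \<delta>) ^ (s + 1) * \<delta>" if "\<delta> > 0" for \<delta>
      using bound[OF that] C by (simp add: pos_divide_le_eq mult.commute)
    then show ?thesis
      using C by (intro exI[of _ "1 / C"]) (auto simp: N_def)
  qed
qed

section \<open>Irrational rotations and codings of rank one\<close>

text \<open>Compactness makes the density of the orbit uniform: one initial segment of length \<open>L\<close> meets every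
  \<open>\<epsilon>\<close>-ball, and so does each of its translates.\<close>

lemma irrational_rotation_dense:
  assumes "\<gamma> \<notin> \<rat>" "\<epsilon> > 0"
  obtains L :: nat where "\<And>p. \<exists>j\<le>L. dist (circle_of (real j * \<gamma>)) p < \<epsilon>"
proof -
  have cover: "(UNIV :: circle set) \<subseteq> (\<Union>j::nat. ball (circle_of (real j * \<gamma>)) \<epsilon>)"
  proof
    fix p :: circle
    obtain t where t: "p = circle_of t" by (rule circle_of_surj)
    obtain k where k: "\<bar>frac (real k * \<gamma>) - frac t\<bar> < \<epsilon>"
      using Kronecker_approx_1_explicit[OF assms(1) _ _ assms(2), of "frac t"] by (metis frac_ge_0 frac_lt_1 less_imp_le)
    have "dist (circle_of (real k * \<gamma>)) p \<le> \<bar>frac (real k * \<gamma>) - frac t\<bar>"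
      unfolding t by (metis circle_of_frac dist_circle_of_le_abs)
    then have "p \<in> ball (circle_of (real k * \<gamma>)) \<epsilon>"
      using k by simp
    then show "p \<in> (\<Union>j::nat. ball (circle_of (real j * \<gamma>)) \<epsilon>)"
      by blast
  qed
  obtain J where J: "finite J" "(UNIV :: circle set) \<subseteq> (\<Union>j\<in>J. ball (circle_of (real j * \<gamma>)) \<epsilon>)"
    by (rule compactE_image[OF compact_circle _ cover]) auto
  show thesis
  proof (rule that[of "Max (insert 0 J)"])
    fix p
    have "p \<in> (\<Union>j\<in>J. ball (circle_of (real j * \<gamma>)) \<epsilon>)"
      using J(2) by (rule subsetD) simp
    then obtain j where "j \<in> J" "dist (circle_of (real j * \<gamma>)) p < \<epsilon>"
      by auto
    then show "\<exists>j\<le>Max (insert 0 J). dist (circle_of (real j * \<gamma>)) p < \<epsilon>"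
      using J(1) by (intro exI[of _ j]) auto
  qed
qed

lemma closed_contains_rotation:
  assumes "\<gamma> \<notin> \<rat>" "closed C" "\<And>j::nat. g + circle_of (real j * \<gamma>) \<in> C"
  shows "C = UNIV"
proof -
  have "p \<in> closure C" for p
    unfolding closure_approachable
  proof (intro allI impI)
    fix \<epsilon> :: real assume "\<epsilon> > 0"
    then obtain L where "\<And>p. \<exists>j\<le>L. dist (circle_of (real j * \<gamma>)) p < \<epsilon>"
      using irrational_rotation_dense[OF assms(1)] by blast
    then obtain j :: nat where j: "dist (circle_of (real j * \<gamma>)) (p - g) < \<epsilon>"
      by blast
    have "dist (g + circle_of (real j * \<gamma>)) p = dist (circle_of (real j * \<gamma>)) (p - g)"
      using dist_circle_cancel[of "circle_of (real j * \<gamma>)" g "p - g"] by (simp add: add.commute)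
    then show "\<exists>y\<in>C. dist y p < \<epsilon>"
      using j assms(3) by metis
  qed
  then show ?thesis
    using assms(2) by auto
qed

text \<open>In rank one the walk is a sequence of integers with bounded steps that is unbounded in one direction. It passes within \<open>P\<close> of
  every integer on that side, so finitely many translates of \<open>K\<close> contain a half-orbit of the rotation by
  the irrational number \<open>\<tau> 0\<close>.\<close>

lemma lattice_coding_1_interior:
  assumes coding: "lattice_coding x 1 \<tau> c P Z" and "infinite (range x)"
    and K: "closed K" "range x \<subseteq> K"
  shows "interior K \<noteq> {}"
proof -
  have Z: "finite Z" "x n - circle_of (of_int (c n 0) * \<tau> 0) \<in> Z"
    and step: "\<bar>c (Suc n) 0 - c n 0\<bar> \<le> int P" for n
    using coding by (auto simp: lattice_coding_def)
  have irr: "\<tau> 0 \<notin> \<rat>"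
  proof
    assume "\<tau> 0 \<in> \<rat>"
    then obtain p q :: int where "q > 0" "\<tau> 0 = of_int p / of_int q"
      by (meson Rats_cases')
    then have "finite (range x)"
      by (intro lattice_coding_rational_finite[OF coding, of q "\<lambda>_. p"]) auto
    then show False
      using assms(2) by simp
  qed
  have unbounded: "infinite (range (\<lambda>n. c n 0))"
  proof
    assume fin: "finite (range (\<lambda>n. c n 0))"
    have "x n \<in> (\<lambda>(z, b). z + circle_of (of_int b * \<tau> 0)) ` (Z \<times> range (\<lambda>n. c n 0))" for n
      using Z(2)[of n] by (intro image_eqI[of _ _ "(x n - circle_of (of_int (c n 0) * \<tau> 0), c n 0)"]) auto
    then have "range x \<subseteq> (\<lambda>(z, b). z + circle_of (of_int b * \<tau> 0)) ` (Z \<times> range (\<lambda>n. c n 0))"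
      by blast
    then show False
      using assms(2) finite_subset finite_imageI finite_cartesian_product[OF Z(1) fin] by metis
  qed
  \<comment> \<open>changing the signs of \<open>c\<close> and \<open>\<tau>\<close> simultaneously, the walk may be taken unbounded above\<close>
  have "\<exists>e\<in>{1, - 1 :: int}. \<forall>B. \<exists>n. B \<le> e * c n 0"
  proof (rule ccontr)
    assume "\<not> ?thesis"
    then obtain B B' where "\<And>n. c n 0 < B" "\<And>n. - c n 0 < B'"
      by (auto simp: not_le)
    then have "range (\<lambda>n. c n 0) \<subseteq> {- B'..B}"
      by (force intro: less_imp_le simp: minus_less_iff)
    then show False
      using unbounded finite_subset by blast
  qed
  then obtain e :: int where e: "e = 1 \<or> e = - 1" "\<And>B. \<exists>n. B \<le> e * c n 0"
    by blast
  define b where "b n = e * c n 0" for n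
  define t where "t = of_int e * \<tau> 0"
  have bt: "of_int (b n) * t = of_int (c n 0) * \<tau> 0" for n
    using e(1) by (auto simp: b_def t_def)
  have step': "b (Suc n) \<le> b n + int P" for n
    using step[of n] e(1) by (auto simp: b_def)
  have irr': "t \<notin> \<rat>"
    using irr e(1) by (auto simp: t_def)
  define G where "G = (\<lambda>(z, i). - z - circle_of (of_int i * t)) ` (Z \<times> {0..int P})"
  define U where "U = (\<Union>g\<in>G. (\<lambda>p. p + g) ` K)"
  have G: "finite G"
    unfolding G_def using Z(1) by blast
  have "circle_of (of_int (b 0) * t) + circle_of (real j * t) \<in> U" for j
  proof -
    define m where "m = b 0 + int j"
    obtain n where "m \<le> b n"
      using e(2)[of m] by (auto simp: b_def)
    then obtain n where n: "m \<le> b n" "\<forall>n'<n. \<not> m \<le> b n'"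
      using exists_least_iff[of "\<lambda>n. m \<le> b n"] by blast
    have "b n \<le> m + int P"
    proof (cases n)
      case (Suc n')
      then show ?thesis
        using n(2) step'[of n'] by auto
    qed (simp add: m_def)
    then have i: "b n - m \<in> {0..int P}"
      using n(1) by simp
    define z where "z = x n - circle_of (of_int (c n 0) * \<tau> 0)"
    have "- z - circle_of (of_int (b n - m) * t) \<in> G"
      unfolding G_def using i Z(2)[of n] by (intro image_eqI[of _ _ "(z, b n - m)"]) (auto simp: z_def)
    moreover have "x n \<in> K"
      using K(2) by blast
    ultimately have "x n + (- z - circle_of (of_int (b n - m) * t)) \<in> U"
      unfolding U_def by blast
    also have "x n + (- z - circle_of (of_int (b n - m) * t)) = circle_of (of_int m * t)"
      by (simp add: z_def bt[symmetric] left_diff_distrib circle_of_diff)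
    finally show ?thesis
      by (simp add: m_def distrib_right circle_of_add)
  qed
  moreover have "closed U"
    unfolding U_def using G closed_translate[OF K(1)] by blast
  ultimately have "U = UNIV"
    using closed_contains_rotation[OF irr'] by blast
  then show ?thesis
    using interior_finite_translates[OF G K(1)] by (simp add: U_def)
qed

section \<open>The coding given by a rational basis\<close>

lemma common_denominator:
  fixes S :: "rat set"
  assumes "finite S"
  shows "\<exists>Q::int. Q > 0 \<and> (\<forall>q\<in>S. \<exists>k::int. of_int Q * q = of_int k)"
  using assms
proof induction
  case empty
  then show ?case by (auto intro: exI[of _ 1])
next
  case (insert q S)
  then obtain Q :: int where Q: "Q > 0" "\<And>q. q \<in> S \<Longrightarrow> \<exists>k::int. of_int Q * q = of_int k"
    by blast
  obtain a b :: int where ab: "b > 0" "q = of_int a / of_int b"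
    using quotient_of_div quotient_of_denom_pos by (metis surj_pair)
  have "\<exists>k::int. of_int (Q * b) * q' = of_int k" if q': "q' \<in> S" for q'
  proof -
    obtain k :: int where "of_int Q * q' = of_int k"
      using Q(2)[OF q'] by blast
    then have "of_int (Q * b) * q' = of_int (k * b)"
      by (simp add: mult.commute mult.left_commute)
    then show ?thesis by blast
  qed
  moreover have "of_int (Q * b) * q = of_int (Q * a)"
    using ab by simp
  ultimately show ?case
    using Q(1) ab(1) by (intro exI[of _ "Q * b"]) (auto intro!: exI[of _ "Q * a"])
qed

text \<open>Extend \<open>1\<close> to a rational basis \<open>B\<close> of the span inside \<open>{1, \<alpha>\<^sub>1, \<dots>, \<alpha>\<^sub>l}\<close> and let \<open>Q\<close> be a common
  denominator of all coordinates. The coordinates other than that of \<open>1\<close> are counted by the walk; the multiples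
  of \<open>1/Q\<close> coming from \<open>1\<close> take finitely many values on the circle.\<close>

lemma lattice_coding_of_orbit:
  assumes orbit: "is_orbit l \<alpha> x"
    and r: "r = rat_real.dim (rat_real.span (insert 1 (\<alpha> ` {1..l}))) - 1"
  shows "\<exists>\<tau> c P Z. lattice_coding x r \<tau> c P Z"
proof -
  define V where "V = insert (1::real) (\<alpha> ` {1..l})"
  have "rat_real.independent {1}"
    by (simp add: rat_real.dependent_single)
  then obtain B where B: "{1} \<subseteq> B" "B \<subseteq> V" "rat_real.independent B" "V \<subseteq> rat_real.span B"
    using rat_real.maximal_independent_subset_extend[of "{1}" V] by (auto simp: V_def)
  have finB: "finite B"
    using B(2) by (auto simp: V_def intro: finite_subset)
  have "rat_real.span B = rat_real.span (rat_real.span V)"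
    using B by (metis rat_real.span_mono rat_real.span_span rat_real.span_minimal rat_real.subspace_span subset_antisym)
  then have "card B = rat_real.dim (rat_real.span V)"
    using rat_real.dim_eq_card[OF _ B(3)] by simp
  then have card: "card (B - {1}) = r"
    using B(1) finB r by (simp add: V_def)
  obtain h where h: "bij_betw h {..<r} (B - {1})"
    using ex_bij_betw_nat_finite[of "B - {1}"] finB card by (auto simp: atLeast0LessThan)
  have "\<exists>u. \<alpha> i = (\<Sum>v\<in>B. rat_scale (u v) v)" if "i \<in> {1..l}" for i
  proof -
    have "\<alpha> i \<in> rat_real.span B"
      using B(4) that by (auto simp: V_def)
    then show ?thesis
      unfolding rat_real.span_finite[OF finB] by blast
  qed
  then obtain u where u: "\<And>i. i \<in> {1..l} \<Longrightarrow> \<alpha> i = (\<Sum>v\<in>B. rat_scale (u i v) v)"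
    by metis
  have "finite ((\<lambda>(i, v). u i v) ` ({1..l} \<times> B))"
    using finB by blast
  then obtain Q :: int where Q: "Q > 0" "\<forall>q\<in>(\<lambda>(i, v). u i v) ` ({1..l} \<times> B). \<exists>k::int. of_int Q * q = of_int k"
    using common_denominator by blast
  then have "\<forall>i v. \<exists>k. i \<in> {1..l} \<longrightarrow> v \<in> B \<longrightarrow> of_int Q * u i v = of_int k"
    by auto
  then obtain A :: "nat \<Rightarrow> real \<Rightarrow> int" where A: "\<And>i v. \<lbrakk>i \<in> {1..l}; v \<in> B\<rbrakk> \<Longrightarrow> of_int Q * u i v = of_int (A i v)"
    by metis
  have Au: "(of_rat (u i v) :: real) = of_int (A i v) / of_int Q" if "i \<in> {1..l}" "v \<in> B" for i v
  proof -
    have "(of_rat (of_int Q * u i v) :: real) = of_rat (of_int (A i v))"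
      using A[OF that] by simp
    then show ?thesis
      using Q(1) by (simp add: of_rat_mult field_simps)
  qed
  have \<alpha>: "\<alpha> i = of_int (A i 1) / of_int Q + (\<Sum>j<r. of_int (A i (h j)) * (h j / of_int Q))"
    if "i \<in> {1..l}" for i
  proof -
    have "\<alpha> i = (\<Sum>v\<in>B. of_int (A i v) / of_int Q * v)"
      unfolding u[OF that] rat_scale_def using Au[OF that] by simp
    also have "\<dots> = of_int (A i 1) / of_int Q * 1 + (\<Sum>v\<in>B - {1}. of_int (A i v) / of_int Q * v)"
      using B(1) finB by (simp add: sum.remove)
    also have "(\<Sum>v\<in>B - {1}. of_int (A i v) / of_int Q * v) = (\<Sum>j<r. of_int (A i (h j)) / of_int Q * h j)"
      by (rule sum.reindex_bij_betw[OF h, symmetric])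
    finally show ?thesis by simp
  qed
  have "\<forall>n. \<exists>i. i \<in> {1..l} \<and> x (Suc n) - x n = circle_of (\<alpha> i)"
    using orbit unfolding is_orbit_def by blast
  then obtain i where i: "\<And>n. i n \<in> {1..l}" "\<And>n. x (Suc n) - x n = circle_of (\<alpha> (i n))"
    by metis
  define c where "c n j = (\<Sum>k<n. A (i k) (h j))" for n j
  define e where "e n = (\<Sum>k<n. A (i k) 1)" for n
  define \<tau> where "\<tau> j = h j / of_int Q" for j
  have x: "x n = x 0 + circle_of (of_int (e n) / of_int Q + (\<Sum>j<r. of_int (c n j) * \<tau> j))" for n
  proof (induction n)
    case 0
    then show ?case
      by (simp add: e_def c_def zero_circle_def[symmetric])
  next
    case (Suc n)
    have "x (Suc n) = x n + circle_of (\<alpha> (i n))"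
      using i(2)[of n] by (metis add.commute diff_add_cancel)
    also have "\<dots> = x 0 + circle_of (of_int (e n) / of_int Q + (\<Sum>j<r. of_int (c n j) * \<tau> j) + \<alpha> (i n))"
      unfolding Suc.IH by (simp add: circle_of_add add.assoc)
    also have "of_int (e n) / of_int Q + (\<Sum>j<r. of_int (c n j) * \<tau> j) + \<alpha> (i n)
        = of_int (e (Suc n)) / of_int Q + (\<Sum>j<r. of_int (c (Suc n) j) * \<tau> j)"
      unfolding \<alpha>[OF i(1)] by (simp add: e_def c_def \<tau>_def add_divide_distrib distrib_right sum.distrib)
    finally show ?case .
  qed
  define P where "P = 1 + (\<Sum>i\<in>{1..l}. \<Sum>j<r. nat \<bar>A i (h j)\<bar>)"
  define Z where "Z = (\<lambda>p. x 0 + p) ` circle_of ` range (\<lambda>k::int. of_int k / of_int Q)"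
  have "lattice_coding x r \<tau> c P Z"
    unfolding lattice_coding_def
  proof (intro conjI allI impI)
    show "finite Z"
      unfolding Z_def by (rule finite_imageI, rule finite_circle_of_fractions) (use Q(1) in simp)
    show "P > 0"
      by (simp add: P_def)
  next
    fix n
    have "x n - circle_of (\<Sum>j<r. of_int (c n j) * \<tau> j) = x 0 + circle_of (of_int (e n) / of_int Q)"
      unfolding x[of n] circle_of_add by simp
    then show "x n - circle_of (\<Sum>j<r. of_int (c n j) * \<tau> j) \<in> Z"
      unfolding Z_def by blast
  next
    fix n j assume j: "j < r"
    have "nat \<bar>A (i n) (h j)\<bar> \<le> (\<Sum>j<r. nat \<bar>A (i n) (h j)\<bar>)"
      using j by (intro member_le_sum) auto
    also have "\<dots> \<le> (\<Sum>i\<in>{1..l}. \<Sum>j<r. nat \<bar>A i (h j)\<bar>)"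
      using i(1)[of n] by (intro member_le_sum) auto
    finally have "nat \<bar>A (i n) (h j)\<bar> \<le> P"
      by (simp add: P_def)
    then show "\<bar>c (Suc n) j - c n j\<bar> \<le> int P"
      by (simp add: c_def)
  qed
  then show ?thesis by blast
qed

section \<open>Lower bounds for the box dimension\<close>

text \<open>In a coding of least rank \<open>s \<le> r\<close> every nonzero functional takes infinitely many values along the walk,
  because otherwise a coordinate could be eliminated.\<close>

lemma lower_box_dim_of_lattice_coding:
  assumes coding: "\<exists>\<tau> c P Z. lattice_coding x r \<tau> c P Z"
    and "infinite (range x)" "range x \<subseteq> K"
  shows "lower_box_dim K \<ge> ereal (1 / (real r + 1))"
proof -
  define s where "s = (LEAST s. \<exists>\<tau> c P Z. lattice_coding x s \<tau> c P Z)"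
  obtain \<tau> c P Z where s: "lattice_coding x s \<tau> c P Z"
    using LeastI[of "\<lambda>s. \<exists>\<tau> c P Z. lattice_coding x s \<tau> c P Z", OF coding] unfolding s_def by blast
  have "s \<le> r"
    unfolding s_def using coding by (rule Least_le)
  have free: "infinite (range (\<lambda>n. \<Sum>j<s. u j * c n j))" if j: "j < s" "u j \<noteq> 0" for u j
  proof
    assume "finite (range (\<lambda>n. \<Sum>j<s. u j * c n j))"
    then have "\<exists>\<tau> c P Z. lattice_coding x (s - 1) \<tau> c P Z"
      using lattice_coding_reduce[where u = u, OF s j] by blast
    then have "s \<le> s - 1"
      unfolding s_def by (rule Least_le)
    then show False
      using j(1) by simp
  qed
  have "\<exists>C>0. \<forall>\<delta>. 0 < \<delta> \<longrightarrow> \<delta> < 1 \<longrightarrow> C \<le> real (covering_number \<delta> K) ^ (s + 1) * \<delta>"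
    by (rule covering_number_power_ge[OF s assms(2,3)]) (rule free)
  then obtain C where "C > 0" "\<And>\<delta>. \<lbrakk>0 < \<delta>; \<delta> < 1\<rbrakk> \<Longrightarrow> C \<le> real (covering_number \<delta> K) ^ (s + 1) * \<delta>"
    by blast
  then have "lower_box_dim K \<ge> ereal (1 / real (s + 1))"
    by (intro lower_box_dim_ge) auto
  moreover have "1 / (real r + 1) \<le> 1 / real (s + 1)"
    using \<open>s \<le> r\<close> by (intro divide_left_mono) auto
  ultimately show ?thesis
    by (meson ereal_less_eq(3) order_trans)
qed

lemma covering_number_pos:
  fixes A :: "circle set"
  assumes "A \<noteq> {}" "\<delta> > 0"
  shows "covering_number \<delta> A > 0"
proof -
  obtain \<U> where "finite \<U>" "card \<U> = covering_number \<delta> A" "A \<subseteq> \<Union>\<U>"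
    using covering_number_witness[OF assms(2), of A] by metis
  then show ?thesis
    using assms(1) by (metis Union_empty card_gt_0_iff subset_empty)
qed

lemma lower_box_dim_interior:
  fixes K :: "circle set"
  assumes "interior K \<noteq> {}"
  shows "lower_box_dim K \<ge> 1"
proof -
  obtain p where p: "p \<in> interior K"
    using assms by blast
  then obtain e where e: "e > 0" "ball p e \<subseteq> K"
    by (auto simp: mem_interior)
  obtain a where a: "p = circle_of a" by (rule circle_of_surj)
  define \<eta> where "\<eta> = min e (1 / 2)"
  have \<eta>: "0 < \<eta>" "\<eta> \<le> 1 / 2"
    using e(1) by (auto simp: \<eta>_def)
  have arc: "circle_of ` {a..<a + \<eta>} \<subseteq> K"
  proof
    fix q assume "q \<in> circle_of ` {a..<a + \<eta>}"
    then obtain t where t: "q = circle_of t" "a \<le> t" "t < a + \<eta>" by auto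
    have "dist p q \<le> \<bar>a - t\<bar>"
      unfolding a t(1) by (rule dist_circle_of_le_abs)
    then show "q \<in> K"
      using t e(2) by (auto simp: \<eta>_def)
  qed
  have "ereal (1 / real 1) \<le> lower_box_dim K"
  proof (rule lower_box_dim_ge)
    show "\<eta> / 2 > 0"
      using \<eta>(1) by simp
    fix \<delta> :: real assume \<delta>: "0 < \<delta>"
    obtain \<U> where \<U>: "finite \<U>" "card \<U> = covering_number \<delta> K" "K \<subseteq> \<Union>\<U>"
      "\<And>U p q. \<lbrakk>U \<in> \<U>; p \<in> U; q \<in> U\<rbrakk> \<Longrightarrow> dist p q \<le> \<delta>"
      using covering_number_witness[OF \<delta>, of K] by metis
    have "\<eta> \<le> (real (card \<U>) + 1) * \<delta>"
    proof (rule card_cover_of_arc[OF \<U>(1) _ \<eta> \<delta>])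
      show "circle_of ` {a..<a + \<eta>} \<subseteq> \<Union>\<U>"
        using arc \<U>(3) by (rule order_trans)
    qed (rule \<U>(4))
    also have "\<dots> \<le> (2 * real (card \<U>)) * \<delta>"
      using covering_number_pos[of K \<delta>] e(2) p interior_subset \<delta> \<U>(2)
      by (intro mult_right_mono) (auto simp: Suc_le_eq[symmetric])
    finally show "\<eta> / 2 \<le> real (covering_number \<delta> K) ^ 1 * \<delta>"
      using \<U>(2) by simp
  qed simp
  then show ?thesis
    by (simp add: one_ereal_def)
qed

text \<open>The differences of \<open>N\<close> sets of diameter \<open>\<delta>\<close> are at most \<open>N\<^sup>2\<close> sets of diameter \<open>2 \<delta>\<close>, and they cover
  the circle.\<close>

lemma lower_box_dim_difference_set:
  fixes K :: "circle set"
  assumes "algebraic_diff K K = UNIV"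
  shows "lower_box_dim K \<ge> ereal (1 / 2)"
proof -
  have K: "K \<noteq> {}"
    using assms by (auto simp: algebraic_diff_def)
  have "ereal (1 / real 2) \<le> lower_box_dim K"
  proof (rule lower_box_dim_ge)
    show "(1 / 8 :: real) > 0" "(2 :: nat) > 0" by simp_all
    fix \<delta> :: real assume \<delta>: "0 < \<delta>"
    obtain \<U> where \<U>: "finite \<U>" "card \<U> = covering_number \<delta> K" "K \<subseteq> \<Union>\<U>"
      "\<And>U p q. \<lbrakk>U \<in> \<U>; p \<in> U; q \<in> U\<rbrakk> \<Longrightarrow> dist p q \<le> \<delta>"
      using covering_number_witness[OF \<delta>, of K] by metis
    let ?\<V> = "(\<lambda>(U, V). algebraic_diff U V) ` (\<U> \<times> \<U>)"
    have "1 / 2 \<le> (real (card ?\<V>) + 1) * (2 * \<delta>)"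
    proof (rule card_cover_of_arc[of _ 0])
      show "finite ?\<V>"
        using \<U>(1) by blast
      have "algebraic_diff K K \<subseteq> \<Union>?\<V>"
      proof
        fix p assume "p \<in> algebraic_diff K K"
        then obtain a b where "a \<in> K" "b \<in> K" "p = a - b"
          by (auto simp: algebraic_diff_def)
        moreover from this obtain U V where "U \<in> \<U>" "a \<in> U" "V \<in> \<U>" "b \<in> V"
          using \<U>(3) by (meson UnionE subsetD)
        ultimately have p: "p \<in> algebraic_diff U V" and V: "algebraic_diff U V \<in> ?\<V>"
          by (auto simp: algebraic_diff_def)
        show "p \<in> \<Union>?\<V>"
          using V p by (rule UnionI)
      qed
      then show "circle_of ` {0..<0 + 1 / 2} \<subseteq> \<Union>?\<V>"
        using assms by auto
    next
      fix V p q assume "V \<in> ?\<V>" and pq: "p \<in> V" "q \<in> V"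
      then obtain U U' where U: "U \<in> \<U>" "U' \<in> \<U>" "V = algebraic_diff U U'"
        by blast
      obtain a b where "a \<in> U" "b \<in> U'" "p = a - b"
        using pq(1) unfolding U(3) algebraic_diff_def by blast
      moreover obtain a' b' where "a' \<in> U" "b' \<in> U'" "q = a' - b'"
        using pq(2) unfolding U(3) algebraic_diff_def by blast
      ultimately have "p = a - b" "q = a' - b'" "dist a a' \<le> \<delta>" "dist b b' \<le> \<delta>"
        using U(1,2) \<U>(4) by blast+
      then show "dist p q \<le> 2 * \<delta>"
        using dist_circle_diff_le[of a b a' b'] by simp
    qed (use \<delta> in auto)
    also have "\<dots> \<le> (2 * real (card \<U>) ^ 2) * (2 * \<delta>)"
    proof (rule mult_right_mono)
      have "card ?\<V> \<le> card \<U> ^ 2"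
        using card_image_le[of "\<U> \<times> \<U>" "\<lambda>(U, V). algebraic_diff U V"] \<U>(1)
        by (simp add: card_cartesian_product power2_eq_square)
      moreover have "1 \<le> card \<U> ^ 2"
        using covering_number_pos[OF K \<delta>] \<U>(2) by simp
      ultimately have "card ?\<V> + 1 \<le> 2 * card \<U> ^ 2"
        by linarith
      then have "real (card ?\<V> + 1) \<le> real (2 * card \<U> ^ 2)"
        by (rule iffD2[OF of_nat_le_iff])
      then show "real (card ?\<V>) + 1 \<le> 2 * real (card \<U>) ^ 2"
        by simp
    qed (use \<delta> in simp)
    finally show "1 / 8 \<le> real (covering_number \<delta> K) ^ 2 * \<delta>"
      using \<U>(2) by simp
  qed
  then show ?thesis by simp
qed

section \<open>Orbits with two steps\<close>

text \<open>Quasi-additivity gives \<open>(b m - L) / m \<le> (b n + L) / n\<close> for all positive \<open>m\<close> and \<open>n\<close>, by comparing both with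
  \<open>b (m * n)\<close>; any number separating the two families is a slope.\<close>

lemma quasi_additive_slope:
  fixes b :: "nat \<Rightarrow> int"
  assumes quasi: "\<And>m n. \<bar>b (m + n) - b m - b n\<bar> \<le> L"
  obtains \<theta> :: real where "\<And>n. \<bar>of_int (b n) - real n * \<theta>\<bar> \<le> of_int L"
proof -
  have mult: "\<bar>b (Suc m * n) - int (Suc m) * b n\<bar> \<le> int m * L" for m n
  proof (induction m)
    case (Suc m)
    have "\<bar>b (n + Suc m * n) - b n - b (Suc m * n)\<bar> \<le> L"
      by (rule quasi)
    then show ?case
      using Suc by (simp add: algebra_simps abs_le_iff)
  qed simp
  have L: "L \<ge> 0"
    using quasi[of 0 0] by linarith
  have mult': "\<bar>b (m * n) - int m * b n\<bar> \<le> int m * L" if m: "m > 0" for m n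
  proof -
    obtain m' where m': "m = Suc m'"
      using m by (cases m) auto
    have "int m' * L \<le> int m * L"
      using L by (intro mult_right_mono) (simp_all add: m')
    then show ?thesis
      using mult[of m' n] unfolding m' by linarith
  qed
  define f where "f m = (of_int (b m) - of_int L) / real m" for m
  have key: "f m \<le> (of_int (b n) + of_int L) / real n" if "m > 0" "n > 0" for m n
  proof -
    have "int n * b m - int n * L \<le> b (n * m)" "b (m * n) \<le> int m * b n + int m * L"
      using mult'[OF that(1), of n] mult'[OF that(2), of m] by linarith+
    then have "int n * (b m - L) \<le> int m * (b n + L)"
      by (simp add: algebra_simps)
    then have "real_of_int (int n * (b m - L)) \<le> real_of_int (int m * (b n + L))"
      by (rule iffD2[OF of_int_le_iff])
    then have "real n * (of_int (b m) - of_int L) \<le> real m * (of_int (b n) + of_int L)"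
      by simp
    then show ?thesis
      using that by (simp add: f_def field_simps)
  qed
  define \<theta> where "\<theta> = (SUP m\<in>{0<..}. f m)"
  have bdd: "bdd_above (f ` {0<..})"
    using key[of _ 1] by (intro bdd_aboveI2[where M = "(of_int (b 1) + of_int L) / real 1"]) auto
  have "\<bar>of_int (b n) - real n * \<theta>\<bar> \<le> of_int L" for n
  proof (cases "n = 0")
    case True
    then show ?thesis
      using quasi[of 0 0] by simp
  next
    case False
    then have n: "n > 0" by simp
    have "f n \<le> \<theta>"
      unfolding \<theta>_def using bdd n by (intro cSUP_upper) auto
    moreover have "\<theta> \<le> (of_int (b n) + of_int L) / real n"
      unfolding \<theta>_def using key n by (intro cSUP_least) auto
    ultimately show ?thesis
      using n by (simp add: f_def field_simps abs_le_iff)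
  qed
  then show thesis by (rule that)
qed

lemma Rats_quotient: "of_int a / of_int b \<in> \<rat>"
  by (intro Rats_divide Rats_of_int)

text \<open>Kronecker's theorem in dimension two yields an integer multiple; a return time given by Dirichlet's
  theorem makes it nonnegative.\<close>

lemma torus_orbit_dense:
  fixes \<rho> \<theta> t u :: real
  assumes indep: "\<And>k m p :: int. of_int k * \<rho> + of_int m * \<theta> = of_int p \<Longrightarrow> k = 0 \<and> m = 0"
    and "\<epsilon> > 0"
  obtains n :: nat and a b :: int where "\<bar>real n * \<rho> - of_int a - t\<bar> < \<epsilon>" "\<bar>real n * \<theta> - of_int b - u\<bar> < \<epsilon>"
proof -
  define \<xi> where "\<xi> = (\<lambda>i::nat. if i = 0 then \<rho> else if i = 1 then \<theta> else 1)"
  interpret Z: Modules.module "\<lambda>r x. real_of_int r * x"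
    by (simp add: Modules.module.intro distrib_left mult.commute)
  have ne: "\<rho> \<noteq> \<theta>" "\<rho> \<noteq> 1" "\<theta> \<noteq> 1"
    using indep[of 1 "- 1" 0] indep[of 1 0 1] indep[of 0 1 1] by auto
  have img: "\<xi> ` {..2} = {\<rho>, \<theta>, 1}"
    by (auto simp: \<xi>_def numeral_2_eq_2 atMost_Suc)
  have inj: "inj_on \<xi> {..2}"
    using ne by (auto simp: \<xi>_def numeral_2_eq_2 atMost_Suc)
  have "Z.independent {\<rho>, \<theta>, 1}"
  proof
    assume "Z.dependent {\<rho>, \<theta>, 1}"
    then obtain f where f: "\<exists>v\<in>{\<rho>, \<theta>, 1}. f v \<noteq> 0" "(\<Sum>v\<in>{\<rho>, \<theta>, 1}. of_int (f v) * v) = 0"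
      by (auto simp only: Z.dependent_finite[of "{\<rho>, \<theta>, 1}"] finite.intros)
    then have rel: "of_int (f \<rho>) * \<rho> + (of_int (f \<theta>) * \<theta> + of_int (f 1)) = 0"
      using ne by simp
    then have "f \<rho> = 0 \<and> f \<theta> = 0"
      by (intro indep[of _ _ "- f 1"]) simp
    moreover from this rel have "f 1 = 0"
      by simp
    ultimately show False
      using f(1) by auto
  qed
  then have "Z.independent (\<xi> ` {..2})"
    by (simp add: img)
  then obtain k :: int and m where k: "\<And>i. i < 2 \<Longrightarrow> \<bar>of_int k * \<xi> i - of_int (m i) - (if i = 0 then t else u)\<bar> < \<epsilon> / 2"
    using Kronecker_thm_2[of \<xi> 2 "\<epsilon> / 2" "\<lambda>i. if i = 0 then t else u"] inj assms(2) by (auto simp: \<xi>_def)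
  \<comment> \<open>adding \<open>\<bar>k\<bar>\<close> times a return time with error \<open>1/N\<close> to \<open>k\<close> costs at most \<open>\<epsilon>/2\<close>\<close>
  obtain N :: nat where N: "2 * (\<bar>real_of_int k\<bar> + 1) / \<epsilon> < real N"
    using reals_Archimedean2 by blast
  have "0 < 2 * (\<bar>real_of_int k\<bar> + 1) / \<epsilon>"
    using assms(2) by simp
  then have N0: "N > 0"
    using N by linarith
  obtain q :: int and p where q: "0 < q" "\<And>i. i < 2 \<Longrightarrow> \<bar>of_int q * \<xi> i - of_int (p i)\<bar> < 1 / N"
    using Dirichlet_approx_simult[OF N0, of 2 \<xi>] by metis
  have kN: "\<bar>real_of_int k\<bar> * (1 / N) \<le> \<epsilon> / 2"
    using N N0 assms(2) by (simp add: field_simps)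
  have "\<bar>k\<bar> * 1 \<le> \<bar>k\<bar> * q"
    using q(1) by (intro mult_left_mono) auto
  then have nn: "k + \<bar>k\<bar> * q \<ge> 0"
    by linarith
  define n where "n = nat (k + \<bar>k\<bar> * q)"
  have n: "real n = of_int k + \<bar>of_int k\<bar> * of_int q"
    using nn by (simp add: n_def)
  have main: "\<bar>real n * \<xi> i - of_int (m i + \<bar>k\<bar> * p i) - (if i = 0 then t else u)\<bar> < \<epsilon>" if "i < 2" for i
  proof -
    have "real n * \<xi> i - of_int (m i + \<bar>k\<bar> * p i) - (if i = 0 then t else u)
      = (of_int k * \<xi> i - of_int (m i) - (if i = 0 then t else u))
        + \<bar>of_int k\<bar> * (of_int q * \<xi> i - of_int (p i))"
      unfolding n by (simp add: algebra_simps)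
    moreover have "\<bar>\<bar>real_of_int k\<bar> * (of_int q * \<xi> i - of_int (p i))\<bar> \<le> \<bar>real_of_int k\<bar> * (1 / N)"
      unfolding abs_mult abs_idempotent using q(2)[OF that] by (intro mult_left_mono) auto
    ultimately show ?thesis
      using k[OF that] kN by linarith
  qed
  show thesis
    using main[of 0] main[of 1] by (intro that[of n "m 0 + \<bar>k\<bar> * p 0" "m 1 + \<bar>k\<bar> * p 1"]) (simp_all add: \<xi>_def)
qed

text \<open>With \<open>\<rho> = \<alpha> + \<theta> \<gamma>\<close> the sequence is \<open>n \<rho> - frac (n \<theta>) \<gamma>\<close>, the image of the orbit of \<open>(\<rho>, \<theta>)\<close> on the torus
  under a map that is discontinuous only where \<open>n \<theta>\<close> is an integer. For rational \<open>\<theta>\<close> a subsequence is the orbit of an irrational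
  rotation. If \<open>1, \<rho>, \<theta>\<close> are independent, the orbit is dense in the torus. In the remaining case a relation
  \<open>k \<rho> + m \<theta> = p\<close> turns the sequence, up to multiples of \<open>1/k\<close>, into \<open>- \<sigma> frac (n \<theta>)\<close> with
  \<open>\<sigma> = m/k + \<gamma> \<noteq> 0\<close>, which fills an arc.\<close>

lemma floor_sequence_interior:
  fixes \<alpha> \<gamma> \<theta> :: real
  assumes indep: "\<And>k m p :: int. of_int k * \<alpha> + of_int m * \<gamma> = of_int p \<Longrightarrow> k = 0 \<and> m = 0"
    and C: "closed C" "\<And>n::nat. circle_of (real n * \<alpha> + of_int \<lfloor>real n * \<theta>\<rfloor> * \<gamma>) \<in> C"
  shows "interior C \<noteq> {}"
proof (cases "\<theta> \<in> \<rat>")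
  case True
  then obtain p k :: int where k: "k > 0" "\<theta> = of_int p / of_int k"
    by (meson Rats_cases')
  have irr: "of_int k * \<alpha> + of_int p * \<gamma> \<notin> \<rat>"
  proof
    assume "of_int k * \<alpha> + of_int p * \<gamma> \<in> \<rat>"
    then obtain a b :: int where b: "b > 0" "of_int k * \<alpha> + of_int p * \<gamma> = of_int a / of_int b"
      by (meson Rats_cases')
    then have "of_int (b * k) * \<alpha> + of_int (b * p) * \<gamma> = of_int a"
      by (simp add: field_simps)
    then show False
      using indep[of "b * k" "b * p" a] b(1) k(1) by simp
  qed
  have "0 + circle_of (real j * (of_int k * \<alpha> + of_int p * \<gamma>)) \<in> C" for j
  proof -
    have "real (j * nat k) * \<theta> = of_int (int j * p)"
      using k by simp
    then have "\<lfloor>real (j * nat k) * \<theta>\<rfloor> = int j * p"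
      by (metis floor_of_int)
    then have "circle_of (real (j * nat k) * \<alpha> + of_int (int j * p) * \<gamma>) \<in> C"
      using C(2)[of "j * nat k"] by simp
    then show ?thesis
      using k(1) by (simp add: algebra_simps)
  qed
  then have "C = UNIV"
    by (rule closed_contains_rotation[OF irr C(1)])
  then show ?thesis by simp
next
  case irr: False
  define \<rho> where "\<rho> = \<alpha> + \<theta> * \<gamma>"
  have z: "real n * \<alpha> + of_int \<lfloor>real n * \<theta>\<rfloor> * \<gamma> = real n * \<rho> - frac (real n * \<theta>) * \<gamma>" for n
    by (simp add: \<rho>_def frac_def algebra_simps)
  show ?thesis
  proof (cases "\<exists>k m p :: int. of_int k * \<rho> + of_int m * \<theta> = of_int p \<and> \<not> (k = 0 \<and> m = 0)")
    case True
    then obtain k m p :: int where rel: "of_int k * \<rho> + of_int m * \<theta> = of_int p" "\<not> (k = 0 \<and> m = 0)"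
      by blast
    have k: "k \<noteq> 0"
    proof
      assume "k = 0"
      then have "\<theta> = of_int p / of_int m"
        using rel by (simp add: field_simps)
      then show False
        using irr Rats_quotient by metis
    qed
    define \<sigma> where "\<sigma> = of_int m / of_int k + \<gamma>"
    have "\<sigma> \<noteq> 0"
    proof
      assume "\<sigma> = 0"
      then have "of_int 0 * \<alpha> + of_int k * \<gamma> = of_int (- m)"
        using k by (simp add: \<sigma>_def field_simps)
      then show False
        using indep k by blast
    qed
    define G where "G = circle_of ` range (\<lambda>i::int. of_int i / of_int k)"
    define D where "D = (\<Union>g\<in>G. (\<lambda>q. q + g) ` C)"
    have G: "finite G"
      unfolding G_def by (rule finite_circle_of_fractions[OF k])
    have "closed D"
      unfolding D_def using G closed_translate[OF C(1)] by blast
    then have closed: "closed ((\<lambda>v. circle_of (- \<sigma> * v)) -` D)"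
      by (intro closed_vimage continuous_on_compose2[OF continuous_on_circle_of[of UNIV]] continuous_intros) auto
    have "frac (real n * \<theta>) \<in> (\<lambda>v. circle_of (- \<sigma> * v)) -` D" for n
    proof -
      define i where "i = m * \<lfloor>real n * \<theta>\<rfloor> - int n * p"
      have "of_int k * \<rho> = of_int p - of_int m * \<theta>"
        using rel(1) by simp
      then have "of_int k * (real n * \<rho>) = real n * (of_int p - of_int m * \<theta>)"
        by (metis mult.left_commute)
      then have "of_int k * (- \<sigma> * frac (real n * \<theta>))
        = of_int k * (real n * \<rho> - frac (real n * \<theta>) * \<gamma>) + of_int i"
        using k by (simp add: \<sigma>_def i_def frac_def algebra_simps)
      then have "- \<sigma> * frac (real n * \<theta>) = (real n * \<rho> - frac (real n * \<theta>) * \<gamma>) + of_int i / of_int k"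
        using k by (simp add: field_simps)
      then have "circle_of (- \<sigma> * frac (real n * \<theta>))
        = circle_of (real n * \<alpha> + of_int \<lfloor>real n * \<theta>\<rfloor> * \<gamma>) + circle_of (of_int i / of_int k)"
        unfolding z by (simp only: circle_of_add)
      then show ?thesis
        using C(2)[of n] unfolding D_def G_def by auto
    qed
    then have "closure (range (\<lambda>n. frac (real n * \<theta>))) \<subseteq> (\<lambda>v. circle_of (- \<sigma> * v)) -` D"
      using closed by (intro closure_minimal) auto
    then have D: "circle_of (- \<sigma> * v) \<in> D" if "v \<in> {0..1}" for v
      using that Kronecker_approx_1[OF irr] by auto
    have "interior D \<noteq> {}"
    proof (rule circle_of_arc_interior)
      show "min 0 (- \<sigma>) < max 0 (- \<sigma>)"
        using \<open>\<sigma> \<noteq> 0\<close> by auto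
      show "circle_of ` {min 0 (- \<sigma>)<..<max 0 (- \<sigma>)} \<subseteq> D"
      proof
        fix q assume "q \<in> circle_of ` {min 0 (- \<sigma>)<..<max 0 (- \<sigma>)}"
        then obtain s where s: "q = circle_of s" "min 0 (- \<sigma>) < s" "s < max 0 (- \<sigma>)"
          by auto
        have "s / - \<sigma> \<in> {0..1}"
        proof (cases "\<sigma> > 0")
          case True
          then show ?thesis
            using s by (auto simp: field_simps)
        next
          case False
          then have "\<sigma> < 0"
            using \<open>\<sigma> \<noteq> 0\<close> by simp
          then show ?thesis
            using s by (auto simp: field_simps)
        qed
        then show "q \<in> D"
          using D[of "s / - \<sigma>"] \<open>\<sigma> \<noteq> 0\<close> by (simp add: s(1))
      qed
    qed
    then show ?thesis
      using interior_finite_translates[OF G C(1)] by (simp add: D_def)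
  next
    case False
    have "q \<in> closure C" for q
      unfolding closure_approachable
    proof (intro allI impI)
      fix \<epsilon> :: real assume \<epsilon>: "\<epsilon> > 0"
      obtain t where t: "q = circle_of t" by (rule circle_of_surj)
      define e where "e = min (1 / 2) (\<epsilon> / (1 + \<bar>\<gamma>\<bar>))"
      have e: "0 < e" "e \<le> 1 / 2" "e * (1 + \<bar>\<gamma>\<bar>) \<le> \<epsilon>"
      proof -
        show "0 < e"
          using \<epsilon> by (simp add: e_def)
        show "e \<le> 1 / 2"
          unfolding e_def by (rule min.cobounded1)
        have "e \<le> \<epsilon> / (1 + \<bar>\<gamma>\<bar>)"
          by (simp add: e_def)
        then show "e * (1 + \<bar>\<gamma>\<bar>) \<le> \<epsilon>"
          by (simp add: pos_le_divide_eq add_pos_nonneg)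
      qed
      \<comment> \<open>aiming at fractional part \<open>1/2\<close> for \<open>n \<theta>\<close> stays away from the discontinuity of \<open>frac\<close>\<close>
      obtain n :: nat and a b :: int where n: "\<bar>real n * \<rho> - of_int a - (t + \<gamma> / 2)\<bar> < e"
        "\<bar>real n * \<theta> - of_int b - 1 / 2\<bar> < e"
        using torus_orbit_dense[of \<rho> \<theta> e "t + \<gamma> / 2" "1 / 2"] False e(1) by metis
      have "\<lfloor>real n * \<theta>\<rfloor> = b"
        using n(2) e(2) by (intro floor_unique) linarith+
      then have frac: "\<bar>frac (real n * \<theta>) - 1 / 2\<bar> < e"
        using n(2) by (simp add: frac_def)
      have "dist (circle_of (real n * \<rho> - frac (real n * \<theta>) * \<gamma>)) q
          \<le> \<bar>real n * \<rho> - frac (real n * \<theta>) * \<gamma> - t - of_int a\<bar>"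
        unfolding t by (rule dist_circle_of_le)
      also have "\<dots> = \<bar>(real n * \<rho> - of_int a - (t + \<gamma> / 2)) - (frac (real n * \<theta>) - 1 / 2) * \<gamma>\<bar>"
        by (simp add: algebra_simps)
      also have "\<dots> \<le> \<bar>real n * \<rho> - of_int a - (t + \<gamma> / 2)\<bar> + \<bar>frac (real n * \<theta>) - 1 / 2\<bar> * \<bar>\<gamma>\<bar>"
        using abs_triangle_ineq4 by (simp only: abs_mult[symmetric])
      also have "\<dots> < e + e * \<bar>\<gamma>\<bar>"
        using n(1) frac by (intro add_less_le_mono mult_right_mono) auto
      also have "\<dots> \<le> \<epsilon>"
        using e(3) by (simp add: algebra_simps)
      finally show "\<exists>y\<in>C. dist y q < \<epsilon>"
        using C(2)[of n] unfolding z by blast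
    qed
    then have "C = UNIV"
      using C(1) by auto
    then show ?thesis by simp
  qed
qed

lemma compact_algebraic_diff:
  fixes A B :: "circle set"
  assumes "compact A" "compact B"
  shows "compact (algebraic_diff A B)"
proof -
  have "continuous_on (A \<times> B) (\<lambda>(a, b). a - b)"
    unfolding continuous_on_iff
  proof (intro ballI allI impI)
    fix p :: "circle \<times> circle" and \<epsilon> :: real assume "\<epsilon> > 0"
    show "\<exists>d>0. \<forall>p'\<in>A \<times> B. dist p' p < d \<longrightarrow> dist (case p' of (a, b) \<Rightarrow> a - b) (case p of (a, b) \<Rightarrow> a - b) < \<epsilon>"
    proof (intro exI[of _ "\<epsilon> / 2"] conjI ballI impI)
      fix p' :: "circle \<times> circle" assume "dist p' p < \<epsilon> / 2"
      then have "dist (fst p') (fst p) < \<epsilon> / 2" "dist (snd p') (snd p) < \<epsilon> / 2"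
        using dist_fst_le[of p' p] dist_snd_le[of p' p] by linarith+
      then show "dist (case p' of (a, b) \<Rightarrow> a - b) (case p of (a, b) \<Rightarrow> a - b) < \<epsilon>"
        using dist_circle_diff_le[of "fst p'" "snd p'" "fst p" "snd p"] by (simp add: case_prod_beta)
    qed (use \<open>\<epsilon> > 0\<close> in simp)
  qed
  then have "compact ((\<lambda>(a, b). a - b) ` (A \<times> B))"
    using assms by (intro compact_continuous_image compact_Times)
  moreover have "(\<lambda>(a, b). a - b) ` (A \<times> B) = algebraic_diff A B"
    by (force simp: algebraic_diff_def)
  ultimately show ?thesis by simp
qed

lemma unit_step_intermediate_value:
  fixes f :: "nat \<Rightarrow> int"
  assumes "\<And>n. \<bar>f (Suc n) - f n\<bar> \<le> 1" "f m \<le> v" "v \<le> f n"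
  obtains i where "f i = v"
proof (cases "m \<le> n")
  case True
  then show thesis
    using nat_intermed_int_val[of m n f v] assms that by (metis le_neq_implies_less order_antisym)
next
  case False
  then show thesis
    using nat_intermed_int_val[of n m "\<lambda>i. - f i" "- v"] assms that
    by (auto simp: abs_minus_commute)
qed

text \<open>The alternative is whether the number of steps \<open>\<beta>\<close> among \<open>m\<close> consecutive steps varies unboundedly as \<open>m\<close> grows.
  In the unbounded case the intermediate value property produces long runs of multiples of \<open>\<gamma> = \<beta> - \<alpha>\<close> in
  \<open>K - K\<close>; in the bounded case the count is \<open>n \<theta>\<close> up to a bounded error, and the orbit follows
  \<open>n \<alpha> + \<lfloor>n \<theta>\<rfloor> \<gamma>\<close> up to finitely many translations.\<close>

lemma two_step_orbit_difference_or_interior: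
  fixes x :: "nat \<Rightarrow> circle"
  assumes steps: "\<And>n. x (Suc n) - x n \<in> {circle_of \<alpha>, circle_of \<beta>}"
    and indep: "\<And>k m p :: int. of_int k * \<alpha> + of_int m * \<beta> = of_int p \<Longrightarrow> k = 0 \<and> m = 0"
    and K: "closed K" "range x \<subseteq> K"
  shows "algebraic_diff K K = UNIV \<or> interior K \<noteq> {}"
proof -
  define \<gamma> where "\<gamma> = \<beta> - \<alpha>"
  have indep': "k = 0 \<and> m = 0" if "of_int k * \<alpha> + of_int m * \<gamma> = of_int p" for k m p :: int
  proof -
    have "of_int (k - m) * \<alpha> + of_int m * \<beta> = of_int p"
      using that by (simp add: \<gamma>_def algebra_simps)
    then have "k - m = 0 \<and> m = 0"
      by (rule indep)
    then show ?thesis by simp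
  qed
  have irr: "\<gamma> \<notin> \<rat>"
  proof
    assume "\<gamma> \<in> \<rat>"
    then obtain p k :: int where "k > 0" "\<gamma> = of_int p / of_int k"
      by (meson Rats_cases')
    then have "of_int 0 * \<alpha> + of_int k * \<gamma> = of_int p"
      by simp
    then show False
      using indep' \<open>k > 0\<close> by blast
  qed
  define b where "b n = (\<Sum>i<n. if x (Suc i) - x i = circle_of \<beta> then 1 else 0 :: int)" for n
  have b_step: "b (Suc n) - b n \<in> {0, 1}" for n
    by (simp add: b_def)
  have x: "x n = x 0 + circle_of (real n * \<alpha> + of_int (b n) * \<gamma>)" for n
  proof (induction n)
    case 0
    then show ?case
      by (simp add: b_def zero_circle_def[symmetric])
  next
    case (Suc n)
    have "x (Suc n) - x n = circle_of (\<alpha> + of_int (b (Suc n) - b n) * \<gamma>)"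
      using steps[of n] by (auto simp: b_def \<gamma>_def)
    then have "x (Suc n) = x n + circle_of (\<alpha> + of_int (b (Suc n) - b n) * \<gamma>)"
      by (metis add.commute diff_add_cancel)
    also have "\<dots> = x 0 + circle_of ((real n * \<alpha> + of_int (b n) * \<gamma>) + (\<alpha> + of_int (b (Suc n) - b n) * \<gamma>))"
      by (subst Suc.IH) (simp only: circle_of_add add.assoc)
    also have "(real n * \<alpha> + of_int (b n) * \<gamma>) + (\<alpha> + of_int (b (Suc n) - b n) * \<gamma>)
        = real (Suc n) * \<alpha> + of_int (b (Suc n)) * \<gamma>"
      by (simp add: algebra_simps)
    finally show ?case .
  qed
  define f where "f m n = b (n + m) - b n" for m n
  have f_step: "\<bar>f m (Suc n) - f m n\<bar> \<le> 1" for m n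
    using b_step[of "n + m"] b_step[of n] by (auto simp: f_def)
  have x_diff: "x (n + m) - x n = circle_of (real m * \<alpha> + of_int (f m n) * \<gamma>)" for m n
    unfolding x[of "n + m"] x[of n] add_diff_cancel_left circle_of_diff[symmetric]
    by (simp add: f_def algebra_simps)
  show ?thesis
  proof (cases "\<exists>L. \<forall>m n n'. f m n' - f m n \<le> L")
    case False
    have "p \<in> closure (algebraic_diff K K)" for p
      unfolding closure_approachable
    proof (intro allI impI)
      fix \<epsilon> :: real assume "\<epsilon> > 0"
      then obtain L where L: "\<And>p. \<exists>j\<le>L. dist (circle_of (real j * \<gamma>)) p < \<epsilon>"
        using irrational_rotation_dense[OF irr] by blast
      obtain m n n' where mn: "int L < f m n' - f m n"
        using False by (metis not_le)
      define g where "g = circle_of (real m * \<alpha> + of_int (f m n) * \<gamma>)"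
      obtain j :: nat where j: "j \<le> L" "dist (circle_of (real j * \<gamma>)) (p - g) < \<epsilon>"
        using L by blast
      obtain i where i: "f m i = f m n + int j"
        using unit_step_intermediate_value[of "f m" n "f m n + int j" n'] f_step mn j(1) by auto
      have "x (i + m) - x i = circle_of (real j * \<gamma>) + g"
        unfolding x_diff i g_def circle_of_add[symmetric] by (simp add: algebra_simps)
      then have "circle_of (real j * \<gamma>) + g = x (i + m) - x i"
        by (rule sym)
      moreover have "x (i + m) \<in> K" "x i \<in> K"
        using K(2) by blast+
      ultimately have "circle_of (real j * \<gamma>) + g \<in> algebraic_diff K K"
        unfolding algebraic_diff_def mem_Collect_eq by blast
      moreover have "dist (circle_of (real j * \<gamma>) + g) p < \<epsilon>"
        using j(2) dist_circle_cancel[of "circle_of (real j * \<gamma>)" g "p - g"] by simp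
      ultimately show "\<exists>y\<in>algebraic_diff K K. dist y p < \<epsilon>" by blast
    qed
    moreover have "compact K"
      using compact_circle K(1) by (metis compact_Int_closed inf_top_left)
    ultimately have "algebraic_diff K K = UNIV"
      using compact_imp_closed[OF compact_algebraic_diff] by auto
    then show ?thesis ..
  next
    case True
    then obtain L where L: "\<And>m n n'. f m n' - f m n \<le> L" by blast
    have "b 0 = 0"
      by (simp add: b_def)
    then have "\<bar>b (m + n) - b m - b n\<bar> \<le> L" for m n
      using L[of n m 0] L[of n 0 m] by (simp add: f_def abs_le_iff)
    then obtain \<theta> :: real where \<theta>: "\<And>n. \<bar>of_int (b n) - real n * \<theta>\<bar> \<le> of_int L"
      using quasi_additive_slope by blast
    define G where "G = (\<lambda>j. - x 0 - circle_of (of_int j * \<gamma>)) ` {- L..L + 1}"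
    define C where "C = (\<Union>g\<in>G. (\<lambda>q. q + g) ` K)"
    have G: "finite G"
      by (simp add: G_def)
    have "circle_of (real n * \<alpha> + of_int \<lfloor>real n * \<theta>\<rfloor> * \<gamma>) \<in> C" for n
    proof -
      define j where "j = b n - \<lfloor>real n * \<theta>\<rfloor>"
      have "of_int (b n) - real n * \<theta> \<le> of_int L" "- of_int L \<le> of_int (b n) - real n * \<theta>"
        using \<theta>[of n] by linarith+
      then have "j \<in> {- L..L + 1}"
        unfolding j_def by (auto; linarith)
      then have "- x 0 - circle_of (of_int j * \<gamma>) \<in> G"
        by (simp add: G_def)
      moreover have "circle_of (real n * \<alpha> + of_int \<lfloor>real n * \<theta>\<rfloor> * \<gamma>)
          = x n + (- x 0 - circle_of (of_int j * \<gamma>))"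
      proof -
        have eq: "real n * \<alpha> + of_int \<lfloor>real n * \<theta>\<rfloor> * \<gamma> = (real n * \<alpha> + of_int (b n) * \<gamma>) - of_int j * \<gamma>"
          by (simp add: j_def algebra_simps)
        show ?thesis
          unfolding eq x[of n] circle_of_diff by simp
      qed
      ultimately show ?thesis
        using K(2) unfolding C_def by blast
    qed
    moreover have "closed C"
      unfolding C_def using G closed_translate[OF K(1)] by blast
    ultimately have "interior C \<noteq> {}"
      by (intro floor_sequence_interior[of \<alpha> \<gamma> C \<theta>] indep')
    then show ?thesis
      using interior_finite_translates[OF G K(1)] by (simp add: C_def)
  qed
qed

lemma rationally_independent_if_dim_ge_3:
  fixes a b :: real
  assumes "rat_real.dim (rat_real.span {1, a, b}) \<ge> 3"
    and rel: "of_int k * a + of_int m * b = of_int p"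
  shows "k = 0"
proof (rule ccontr)
  assume k: "k \<noteq> 0"
  have a: "a = rat_scale (of_int p / of_int k) 1 - rat_scale (of_int m / of_int k) b"
    using k rel by (simp add: rat_scale_def of_rat_divide field_simps)
  have "a \<in> rat_real.span {1, b}"
    by (subst a) (intro rat_real.span_diff rat_real.span_scale rat_real.span_base; simp)
  then have "{1, a, b} \<subseteq> rat_real.span {1, b}"
    by (auto intro: rat_real.span_base)
  then have "rat_real.dim {1, a, b} \<le> card {1, b}"
    by (rule rat_real.dim_le_card) simp
  also have "\<dots> \<le> 2"
    by (simp add: card_insert_if)
  finally show False
    using assms(1) by simp
qed

section \<open>Interior and dimension of orbit closures\<close>

theorem theorem1p5:
  fixes l :: nat and \<alpha> :: "nat \<Rightarrow> real" and x :: "nat \<Rightarrow> circle"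
    and K :: "circle set" and r :: nat
  assumes "l \<ge> 2"
    and "is_orbit l \<alpha> x"
    and "infinite (range x)"
    and "K = closure (range x)"
    and "r = rat_real.dim (rat_real.span (insert 1 (\<alpha> ` {1..l}))) - 1"
  shows "(l = 2 \<longrightarrow>
            (algebraic_diff K K = UNIV \<or> interior K \<noteq> {}) \<and> lower_box_dim K \<ge> ereal (1 / 2))
       \<and> (r = 1 \<longrightarrow> lower_box_dim K \<ge> 1)
       \<and> (r > 1 \<longrightarrow> lower_box_dim K \<ge> ereal (1 / (real r + 1)))"
proof -
  have K: "closed K" "range x \<subseteq> K"
    unfolding assms(4) by (rule closed_closure, rule closure_subset)
  obtain \<tau> c P Z where coding: "lattice_coding x r \<tau> c P Z"
    using lattice_coding_of_orbit[OF assms(2,5)] by blast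
  have interior: "interior K \<noteq> {}" if "r = 1"
    using lattice_coding_1_interior[of x \<tau> c P Z K] coding that assms(3) K by simp
  have r0: "r \<noteq> 0"
  proof
    assume "r = 0"
    then have "range x \<subseteq> Z" "finite Z"
      using coding by (auto simp: lattice_coding_def zero_circle_def[symmetric])
    then show False
      using assms(3) finite_subset by blast
  qed
  have two: "algebraic_diff K K = UNIV \<or> interior K \<noteq> {}" if l: "l = 2"
  proof (cases "r = 1")
    case True
    then show ?thesis
      using interior by blast
  next
    case False
    have I: "{1..2::nat} = {1, 2}" by auto
    have "insert 1 (\<alpha> ` {1..l}) = {1, \<alpha> 1, \<alpha> 2}"
      unfolding l I by simp
    then have "r = rat_real.dim (rat_real.span {1, \<alpha> 1, \<alpha> 2}) - 1"
      using assms(5) by (simp only:)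
    then have dim: "rat_real.dim (rat_real.span {1, \<alpha> 1, \<alpha> 2}) \<ge> 3"
      using r0 False by linarith
    show ?thesis
    proof (rule two_step_orbit_difference_or_interior[of x "\<alpha> 1" "\<alpha> 2", OF _ _ K])
      show "x (Suc n) - x n \<in> {circle_of (\<alpha> 1), circle_of (\<alpha> 2)}" for n
        using assms(2) unfolding is_orbit_def l I by simp
      show "k = 0 \<and> m = 0" if rel: "of_int k * \<alpha> 1 + of_int m * \<alpha> 2 = of_int p" for k m p :: int
        using rationally_independent_if_dim_ge_3[OF dim rel]
          rationally_independent_if_dim_ge_3[of "\<alpha> 2" "\<alpha> 1" m k p] dim rel
        by (simp add: insert_commute add.commute)
    qed
  qed
  have half: "lower_box_dim K \<ge> ereal (1 / 2)" if "l = 2"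
    using two[OF that]
  proof
    assume "interior K \<noteq> {}"
    then have "1 \<le> lower_box_dim K"
      by (rule lower_box_dim_interior)
    moreover have "ereal (1 / 2) \<le> 1"
      by (simp add: one_ereal_def)
    ultimately show ?thesis
      by (rule order_trans[rotated])
  qed (rule lower_box_dim_difference_set)
  have "lower_box_dim K \<ge> ereal (1 / (real r + 1))"
    using lower_box_dim_of_lattice_coding[of x r K] coding assms(3) K(2) by blast
  then show ?thesis
    using two half interior lower_box_dim_interior by blast
qed

end
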